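(* Let $\alpha_1,\alpha_2\in\{-1,1\}$ and let $W_{\alpha_1}(N,\mathbf Y)$ and $W_{\alpha_2}(M,\mathbf Z)$ be CCR random variables (see context), the support of $W_{\alpha_2}(M,\mathbf Z)$ being contained in the support of $W_{\alpha_1}(N,\mathbf Y)$. Write $W=W_{\alpha_2}(M,\mathbf Z)$. (i) Suppose that the $Y_i$ and the $Z_i$ have differentiable pdfs $f_Y$ and $f_Z$ and score functions $\rho_Y=f_Y'/f_Y$ and $\rho_Z=f_Z'/f_Z$. Then for any test function $h$ such that the $W_{\alpha_1}(N,\mathbf Y)$-Stein equation $$g'(w)+\rho_{W_{\alpha_1}(N,\mathbf Y)}(w)\,g(w)=h(w)-\mathbb E h(W_{\alpha_1}(N,\mathbf Y))$$ has a solution $g=g_h$, $$\left|\mathbb E h(W_{\alpha_1}(N,\mathbf Y))-\mathbb E h(W_{\alpha_2}(M,\mathbf Z))\right|=\left|\mathbb E\, g(W)\left(\alpha_1 f_Y(W)\frac{(G_N''\circ U_Y^{\alpha_1})(W)}{(G_N'\circ U_Y^{\alpha_1})(W)}-\alpha_2 f_Z(W)\frac{(G_M''\circ U_Z^{\alpha_2})(W)}{(G_M'\circ U_Z^{\alpha_2})(W)}\right)+\mathbb E\, g(W)(\rho_Y-\rho_Z)(W)\right|.$$ (ii) When the $Y_i$ are discrete with pmf $f_Y$ and the $Z_i$ are discrete with pmf $f_Z$ (with values in $\mathbb N$), then for any test function $h$ such that the $W_{\alpha_1}(N,\mathbf Y)$-Stein equation (now with the discrete backward score Stein operator, see context) has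 a solution $g=g_h$, $$\left|\mathbb E h(W_{\alpha_1}(N,\mathbf Y))-\mathbb E h(W_{\alpha_2}(M,\mathbf Z))\right|=\left|\mathbb E\, g(W-1)\left(f_Y(W)\frac{\Delta^-(\Delta^-(G_N\circ U_Y^{\alpha_1}))(W)}{\Delta^-(G_N\circ U_Y^{\alpha_1})(W)}-f_Z(W)\frac{\Delta^-(\Delta^-(G_M\circ U_Z^{\alpha_2}))(W)}{\Delta^-(G_M\circ U_Z^{\alpha_2})(W)}\right)\right|.$$
   Context: $\mathbb N=\{1,2,\dots\}$. $\Delta^-g(x)=g(x)-g(x-1)$. Convention $0/0=0$. CCR random variables: let $N$ be an $\mathbb N$-valued random variable with finite second moment and $\mathbf Y=(Y_1,Y_2,\dots)$ a sequence of positive i.i.d. random variables with cdf $F_Y$, independent of $N$. For $\alpha\in\{-1,1\}$, $W_\alpha(N,\mathbf Y)=\min\{Y_1,\dots,Y_N\}$ if $\alpha=-1$ and $W_\alpha(N,\mathbf Y)=\max\{Y_1,\dots,Y_N\}$ if $\alpha=1$. Put $U_Y^{\alpha}=1-F_Y$ if $\alpha=-1$ and $U_Y^\alpha=F_Y$ if $\alpha=1$; $G_N(x)=\mathbb E x^N$ is the probability generating function of $N$. Analogously for $(M,\mathbf Z)$. Continuous case: $W_\alpha(N,\mathbf Y)$ has pdf $f_Y(w)(G_N'\circ U_Y^\alpha)(w)$ and score function $\rho_{W_\alpha(N,\mathbf Y)}(w)=\alpha f_Y(w)\frac{(G_N''\circ U_Y^\alpha)(w)}{(G_N'\circ U_Y^\alpha)(w)}+\rho_Y(w)$.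 Discrete case: $W_\alpha(N,\mathbf Y)$ has pmf $\alpha\Delta^-(G_N\circ U_Y^\alpha)(w)$ and backward score function $\rho_{W_\alpha(N,\mathbf Y)}(w)=\frac{\Delta^-(\Delta^-(G_N\circ U_Y^\alpha))(w)}{\Delta^-(G_N\circ U_Y^\alpha)(w)}$. The discrete backward score Stein operator maps $g$ to $\Delta^-g(w)+\rho_{W_\alpha(N,\mathbf Y)}(w)\,g(w-1)$, and the Stein equation sets this equal to $h(w)-\mathbb E h(W_\alpha(N,\mathbf Y))$.
   Formalization: In (ii) the false factors f_Y(W), f_Z(W) are dropped and g must vanish at right endpoints of both supports; in (i) g times the pdf of W_{α1}(N,Y) must tend to 0 at finite boundary points of its support; all displayed expectations are assumed to exist. *)

theory Defs
  imports "HOL-Probability.Probability"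
begin

text \<open>
  The law of a pair (N, Y): a random number of terms with values in {1, 2, ...} and finite second
  moment, and an independent sequence of positive i.i.d. random variables, indexed by i = 1, 2, ...
  (the value of Y at index 0 plays no role).
\<close>

locale ccr = prob_space P for P :: "'a measure" +
  fixes N :: "'a \<Rightarrow> nat" and Y :: "nat \<Rightarrow> 'a \<Rightarrow> real"
  assumes N_measurable: "N \<in> measurable P (count_space UNIV)"
    and N_ge_1: "AE \<omega> in P. N \<omega> \<ge> 1"
    and N_second_moment: "integrable P (\<lambda>\<omega>. (real (N \<omega>))\<^sup>2)"
    and Y_measurable: "\<And>i. i \<ge> 1 \<Longrightarrow> Y i \<in> borel_measurable P"
    and Y_pos: "\<And>i. i \<ge> 1 \<Longrightarrow> AE \<omega> in P. 0 < Y i \<omega>"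
    and Y_indep: "indep_vars (\<lambda>_. borel) Y {1..}"
    and Y_ident: "\<And>i. i \<ge> 1 \<Longrightarrow> distr P borel (Y i) = distr P borel (Y 1)"
    and N_Y_indep: "indep_set
          (sets (vimage_algebra (space P) N (count_space UNIV)))
          (sets (vimage_algebra (space P) (\<lambda>\<omega>. \<lambda>i\<in>{1..}. Y i \<omega>) (Pi\<^sub>M {1..} (\<lambda>_. borel))))"

definition ccr_W :: "real \<Rightarrow> ('a \<Rightarrow> nat) \<Rightarrow> (nat \<Rightarrow> 'a \<Rightarrow> real) \<Rightarrow> 'a \<Rightarrow> real" where
  "ccr_W \<alpha> N Y \<omega> =
     (if \<alpha> = -1 then Min ((\<lambda>i. Y i \<omega>) ` {1..N \<omega>}) else Max ((\<lambda>i. Y i \<omega>) ` {1..N \<omega>}))"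

definition ccr_U :: "real \<Rightarrow> 'a measure \<Rightarrow> (nat \<Rightarrow> 'a \<Rightarrow> real) \<Rightarrow> real \<Rightarrow> real" where
  "ccr_U \<alpha> P Y w =
     (if \<alpha> = -1 then 1 - cdf (distr P borel (Y 1)) w else cdf (distr P borel (Y 1)) w)"

definition pgf :: "'a measure \<Rightarrow> ('a \<Rightarrow> nat) \<Rightarrow> real \<Rightarrow> real" where
  "pgf P N x = (\<integral>\<omega>. x ^ N \<omega> \<partial>P)"

text \<open>
  The generating function is only guaranteed to exist on [0, 1], so its derivatives are taken within
  that interval (one-sided at 0 and 1, where they equal P(N = 1), E N etc.).
\<close>

definition pgf' :: "'a measure \<Rightarrow> ('a \<Rightarrow> nat) \<Rightarrow> real \<Rightarrow> real" where
  "pgf' P N x = vector_derivative (pgf P N) (at x within {0..1})"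

definition pgf'' :: "'a measure \<Rightarrow> ('a \<Rightarrow> nat) \<Rightarrow> real \<Rightarrow> real" where
  "pgf'' P N x = vector_derivative (pgf' P N) (at x within {0..1})"

text \<open>The support of (the law of) a real random variable.\<close>

definition rv_support :: "'a measure \<Rightarrow> ('a \<Rightarrow> real) \<Rightarrow> real set" where
  "rv_support P X = {x. \<forall>e>0. measure P {\<omega> \<in> space P. dist (X \<omega>) x < e} > 0}"


subsection \<open>Continuous case\<close>

text \<open>
  The state space of the positive variables is the open half-line, and differentiability of the
  density is required there; this admits densities such as the exponential one, which jump at 0.
\<close>

definition has_differentiable_pdf ::
    "'a measure \<Rightarrow> (nat \<Rightarrow> 'a \<Rightarrow> real) \<Rightarrow> (real \<Rightarrow> real) \<Rightarrow> bool" where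
  "has_differentiable_pdf P Y f \<longleftrightarrow>
     (\<forall>w. 0 \<le> f w) \<and> (\<forall>i\<ge>1. distributed P lborel (Y i) f) \<and> (\<forall>w>0. f differentiable (at w))"

definition score :: "(real \<Rightarrow> real) \<Rightarrow> real \<Rightarrow> real" where
  "score f w = deriv f w / f w"

definition ccr_pdf ::
    "real \<Rightarrow> 'a measure \<Rightarrow> ('a \<Rightarrow> nat) \<Rightarrow> (nat \<Rightarrow> 'a \<Rightarrow> real) \<Rightarrow> (real \<Rightarrow> real) \<Rightarrow> real \<Rightarrow> real" where
  "ccr_pdf \<alpha> P N Y f w = f w * pgf' P N (ccr_U \<alpha> P Y w)"

definition ccr_score ::
    "real \<Rightarrow> 'a measure \<Rightarrow> ('a \<Rightarrow> nat) \<Rightarrow> (nat \<Rightarrow> 'a \<Rightarrow> real) \<Rightarrow> (real \<Rightarrow> real) \<Rightarrow> real \<Rightarrow> real" where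
  "ccr_score \<alpha> P N Y f w =
     \<alpha> * f w * (pgf'' P N (ccr_U \<alpha> P Y w) / pgf' P N (ccr_U \<alpha> P Y w)) + score f w"

text \<open>
  Solutions of the continuous Stein equation. On an interval support the differential equation
  determines g only up to multiples of the reciprocal of the density p of W; the second clause
  selects the solution in the Stein class of W, for which g p has no boundary terms at the finite
  endpoints of the support. It cannot be omitted: for N = M = 1 and Y, Z exponential with rates 1
  and 2, the function g(w) = exp w solves the equation for h = 0, but
  E (g(Z) (score_Y - score_Z)(Z)) = 2. The clause holds automatically at a when g is bounded near a
  and p vanishes continuously at a.
\<close>

definition stein_solution ::
    "real \<Rightarrow> 'a measure \<Rightarrow> ('a \<Rightarrow> nat) \<Rightarrow> (nat \<Rightarrow> 'a \<Rightarrow> real) \<Rightarrow> (real \<Rightarrow> real)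
      \<Rightarrow> (real \<Rightarrow> real) \<Rightarrow> (real \<Rightarrow> real) \<Rightarrow> bool" where
  "stein_solution \<alpha> P N Y f h g \<longleftrightarrow>
     (\<forall>w \<in> interior (rv_support P (ccr_W \<alpha> N Y)).
        g differentiable (at w) \<and>
        deriv g w + ccr_score \<alpha> P N Y f w * g w = h w - (\<integral>\<omega>. h (ccr_W \<alpha> N Y \<omega>) \<partial>P)) \<and>
     (\<forall>a \<in> frontier (rv_support P (ccr_W \<alpha> N Y)).
        ((\<lambda>w. g w * ccr_pdf \<alpha> P N Y f w) \<longlongrightarrow> 0)
          (at a within interior (rv_support P (ccr_W \<alpha> N Y))))"


subsection \<open>Discrete case\<close>

definition bdiff :: "(real \<Rightarrow> real) \<Rightarrow> real \<Rightarrow> real" where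
  "bdiff g x = g x - g (x - 1)"

definition ccr_bscore ::
    "real \<Rightarrow> 'a measure \<Rightarrow> ('a \<Rightarrow> nat) \<Rightarrow> (nat \<Rightarrow> 'a \<Rightarrow> real) \<Rightarrow> real \<Rightarrow> real" where
  "ccr_bscore \<alpha> P N Y w =
     bdiff (bdiff (pgf P N \<circ> ccr_U \<alpha> P Y)) w / bdiff (pgf P N \<circ> ccr_U \<alpha> P Y) w"

definition discrete_stein_solution ::
    "real \<Rightarrow> 'a measure \<Rightarrow> ('a \<Rightarrow> nat) \<Rightarrow> (nat \<Rightarrow> 'a \<Rightarrow> real)
      \<Rightarrow> (real \<Rightarrow> real) \<Rightarrow> (real \<Rightarrow> real) \<Rightarrow> bool" where
  "discrete_stein_solution \<alpha> P N Y h g \<longleftrightarrow>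
     (\<forall>w \<in> rv_support P (ccr_W \<alpha> N Y).
        bdiff g w + ccr_bscore \<alpha> P N Y w * g (w - 1) =
          h w - (\<integral>\<omega>. h (ccr_W \<alpha> N Y \<omega>) \<partial>P))"

text \<open>
  Boundary condition for the backward operator: the summand p(w) g(w) - p(w - 1) g(w - 1)
  telescopes over a run of support points, leaving p(w) g(w) at a right endpoint w.
  If the support of W is a run, every solution of its own Stein equation satisfies this for W.
  For a second variable, with a smaller support, it has to be imposed: with Y uniform on {1, 2},
  Z = 1, N = M = 1 and h the indicator of 1, every solution has g(1) = 1/2, the two
  expectations of h differ by 1/2, and both backward scores are 1 at the only value of Z.
\<close>

definition vanishes_at_right_endpoints :: "(real \<Rightarrow> real) \<Rightarrow> real set \<Rightarrow> bool" where
  "vanishes_at_right_endpoints g S \<longleftrightarrow> (\<forall>w \<in> S. w + 1 \<notin> S \<longrightarrow> g w = 0)"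

end

theory Submission
  imports Defs
begin

text \<open>
  Let \<open>p\<close>, \<open>q\<close> be the densities of the two variables, \<open>r1 = p' / p\<close> and \<open>r2 = q' / q\<close> their scores
  and \<open>k\<close> the right-hand side of the Stein equation. Then \<open>(g p)' = p k\<close> and
  \<open>(g q)' = q k - q g (r1 - r2)\<close> on the interior of the support of the first variable, and the claim
  is that the second derivative integrates to 0. On each component \<open>g q\<close> has limits at the
  ends, because its derivative is integrable. The boundary condition is about \<open>g p\<close> only, but a
  nonzero limit of \<open>g q\<close> would make the logarithmic derivative \<open>r1 - r2\<close> of \<open>p / q\<close> integrable near
  that end, hence \<open>p / q\<close> bounded below there, and \<open>g p\<close> could not tend to 0. The discrete case is
  the same argument for the increments of \<open>p g\<close> and \<open>q g\<close>.
\<close>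

section \<open>Flux identities\<close>

text \<open>Several features of the setting shape the argument. The interior of the support is an
  arbitrary open subset of the positive half-line, possibly with infinitely many components, so
  integrals are computed componentwise and summed. Either density may vanish inside it;
  \<open>p' = r1 * p\<close> and \<open>q' = r2 * q\<close> survive there because a nonnegative
  function has derivative 0 at a zero and division by zero gives 0. Hence the comparison uses
  \<open>p / q\<close>, formed only where \<open>g * q\<close> stays away from 0, and one base point
  with \<open>p\<close> positive, supplied by density of the positivity set. The derivatives are
  integrable but need not be continuous, so the fundamental theorem of calculus is taken from the
  gauge integral and transferred to the Lebesgue integral. Nothing is known about
  \<open>g * p\<close> at infinity: the right-hand side of the Stein equation has mean 0 under the
  first law, and this scalar identity replaces a boundary condition at the only infinite
  end.\<close>

text \<open>Integrating the logarithmic derivative of \<open>s\<close> bounds the oscillation of its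
  logarithm by the integral of \<open>\<psi>\<close>. Both directions are kept, since the base point
  of the comparison may lie on either side of the other point.\<close>

lemma gronwall_comparable:
  fixes s s' \<psi> :: "real \<Rightarrow> real"
  assumes "x \<le> y"
    and deriv: "\<And>z. z \<in> {x..y} \<Longrightarrow> (s has_real_derivative s' z) (at z within {x..y})"
    and nonneg: "\<And>z. z \<in> {x..y} \<Longrightarrow> 0 \<le> s z"
    and bound: "\<And>z. z \<in> {x..y} \<Longrightarrow> \<bar>s' z\<bar> \<le> \<psi> z * s z"
    and int: "\<psi> integrable_on {x..y}"
    and \<psi>: "\<And>z. z \<in> {x..y} \<Longrightarrow> 0 \<le> \<psi> z"
  shows "s x \<le> s y * exp (integral {x..y} \<psi>)" "s y \<le> s x * exp (integral {x..y} \<psi>)"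
proof -
  define C where "C = integral {x..y} \<psi>"
  have *: "s x + e \<le> (s y + e) * exp C \<and> s y + e \<le> (s x + e) * exp C" if "e > 0" for e
  proof -
    \<comment> \<open>\<open>ln (s + e)\<close> in place of \<open>ln s\<close>, so that zeros of \<open>s\<close> are allowed\<close>
    let ?l = "\<lambda>z. ln (s z + e)"
    have "(?l has_vector_derivative s' z / (s z + e)) (at z within {x..y})" if "z \<in> {x..y}" for z
      unfolding has_real_derivative_iff_has_vector_derivative[symmetric]
      using \<open>e > 0\<close> nonneg[OF that]
      by (auto intro!: derivative_eq_intros deriv[OF that])
    then have I: "((\<lambda>z. s' z / (s z + e)) has_integral (?l y - ?l x)) {x..y}"
      using \<open>x \<le> y\<close> by (rule fundamental_theorem_of_calculus[rotated])
    have "norm (integral {x..y} (\<lambda>z. s' z / (s z + e))) \<le> integral {x..y} \<psi>"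
    proof (rule Henstock_Kurzweil_Integration.integral_norm_bound_integral)
      fix z assume z: "z \<in> {x..y}"
      have "\<bar>s' z\<bar> \<le> \<psi> z * (s z + e)"
        using bound[OF z] \<psi>[OF z] \<open>e > 0\<close> by (simp add: distrib_left add_increasing2)
      then show "norm (s' z / (s z + e)) \<le> \<psi> z"
        using nonneg[OF z] \<open>e > 0\<close> by (simp add: pos_divide_le_eq)
    qed (use I int in auto)
    then have "\<bar>?l y - ?l x\<bar> \<le> C"
      using I by (simp add: integral_unique C_def)
    then have "?l x \<le> ?l y + C" "?l y \<le> ?l x + C" by auto
    then have "exp (?l x) \<le> exp (?l y + C)" "exp (?l y) \<le> exp (?l x + C)" by auto
    then show ?thesis
      using nonneg[of x] nonneg[of y] \<open>x \<le> y\<close> \<open>e > 0\<close> by (simp add: exp_add add_nonneg_pos)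
  qed
  have "((\<lambda>e. s x + e) \<longlongrightarrow> s x + 0) (at_right 0)" "((\<lambda>e. (s y + e) * exp C) \<longlongrightarrow> (s y + 0) * exp C) (at_right 0)"
    "((\<lambda>e. s y + e) \<longlongrightarrow> s y + 0) (at_right 0)" "((\<lambda>e. (s x + e) * exp C) \<longlongrightarrow> (s x + 0) * exp C) (at_right 0)"
    by (intro tendsto_intros)+
  moreover have "\<forall>\<^sub>F e in at_right 0. s x + e \<le> (s y + e) * exp C" "\<forall>\<^sub>F e in at_right 0. s y + e \<le> (s x + e) * exp C"
    using * by (auto simp: eventually_at_filter)
  ultimately show "s x \<le> s y * exp (integral {x..y} \<psi>)" "s y \<le> s x * exp (integral {x..y} \<psi>)"
    unfolding C_def[symmetric]
    using tendsto_le[of "at_right 0" "\<lambda>e. (s y + e) * exp C" "(s y + 0) * exp C" "\<lambda>e. s x + e" "s x + 0"]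
      tendsto_le[of "at_right 0" "\<lambda>e. (s x + e) * exp C" "(s x + 0) * exp C" "\<lambda>e. s y + e" "s y + 0"]
    by auto
qed

section \<open>Fundamental theorem of calculus up to open ends\<close>

text \<open>The gauge integral recovers a function from any everywhere-defined derivative,
  continuous or not, and it agrees with the Lebesgue integral once the latter exists.\<close>

lemma set_lebesgue_integral_FTC:
  fixes F f :: "real \<Rightarrow> real"
  assumes "x \<le> y" "\<And>z. z \<in> {x..y} \<Longrightarrow> (F has_real_derivative f z) (at z)"
    and "set_integrable lborel {x..y} f"
  shows "(LINT z:{x..y}|lborel. f z) = F y - F x"
proof -
  have "(f has_integral (F y - F x)) {x..y}"
    using assms(1,2)
    by (intro fundamental_theorem_of_calculus)
       (auto simp: has_real_derivative_iff_has_vector_derivative has_vector_derivative_at_within)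
  then show ?thesis
    using set_borel_integral_eq_integral(2)[OF assms(3)] by (simp add: integral_unique)
qed

text \<open>Integrability of the derivative up to the missing end makes the integral over
  \<open>{x..b}\<close> converge as \<open>x\<close> approaches \<open>a\<close>, hence also
  \<open>F\<close>.\<close>

lemma FTC_tendsto_at_right:
  fixes F f :: "real \<Rightarrow> real"
  assumes "a < b" and F: "\<And>z. z \<in> {a<..b} \<Longrightarrow> (F has_real_derivative f z) (at z)"
    and int: "set_integrable lborel {a<..b} f"
  shows "(F \<longlongrightarrow> F b - (LINT z:{a<..b}|lborel. f z)) (at_right a)"
proof -
  have "((\<lambda>x. F b - (LINT z:{x..b}|lborel. f z)) \<longlongrightarrow> F b - (LINT z:{a<..b}|lborel. f z)) (at_right a)"
    using \<open>a < b\<close> int by (intro tendsto_intros tendsto_set_lebesgue_integral_at_right) auto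
  moreover have "\<forall>\<^sub>F x in at_right a. F b - (LINT z:{x..b}|lborel. f z) = F x"
    using eventually_at_right_less[of a] eventually_at_right_real[OF \<open>a < b\<close>]
  proof eventually_elim
    case (elim x)
    then have "(LINT z:{x..b}|lborel. f z) = F b - F x"
      by (intro set_lebesgue_integral_FTC F set_integrable_subset[OF int]) auto
    then show ?case by simp
  qed
  ultimately show ?thesis by (rule Lim_transform_eventually)
qed

lemma FTC_tendsto_at_left:
  fixes F f :: "real \<Rightarrow> real"
  assumes "a < b" and F: "\<And>z. z \<in> {a..<b} \<Longrightarrow> (F has_real_derivative f z) (at z)"
    and int: "set_integrable lborel {a..<b} f"
  shows "(F \<longlongrightarrow> F a + (LINT z:{a..<b}|lborel. f z)) (at_left b)"
proof -
  have "((\<lambda>x. F a + (LINT z:{a..x}|lborel. f z)) \<longlongrightarrow> F a + (LINT z:{a..<b}|lborel. f z)) (at_left b)"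
    using \<open>a < b\<close> int by (intro tendsto_intros tendsto_set_lebesgue_integral_at_left) auto
  moreover have "\<forall>\<^sub>F x in at_left b. F a + (LINT z:{a..x}|lborel. f z) = F x"
    using eventually_at_left_real[OF \<open>a < b\<close>]
  proof eventually_elim
    case (elim x)
    then have "(LINT z:{a..x}|lborel. f z) = F x - F a"
      by (intro set_lebesgue_integral_FTC F set_integrable_subset[OF int]) auto
    then show ?case by simp
  qed
  ultimately show ?thesis by (rule Lim_transform_eventually)
qed

lemma FTC_tendsto_at_top:
  fixes F f :: "real \<Rightarrow> real"
  assumes F: "\<And>z. z \<ge> a \<Longrightarrow> (F has_real_derivative f z) (at z)"
    and int: "set_integrable lborel {a..} f"
  shows "(F \<longlongrightarrow> F a + (LINT z:{a..}|lborel. f z)) at_top"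
proof -
  have "((\<lambda>x. F a + (LINT z:{a..x}|lborel. f z)) \<longlongrightarrow> F a + (LINT z:{a..}|lborel. f z)) at_top"
    using int by (intro tendsto_intros tendsto_set_lebesgue_integral_at_top) auto
  moreover have "\<forall>\<^sub>F x in at_top. F a + (LINT z:{a..x}|lborel. f z) = F x"
    using eventually_ge_at_top[of a]
  proof eventually_elim
    case (elim x)
    then have "(LINT z:{a..x}|lborel. f z) = F x - F a"
      by (intro set_lebesgue_integral_FTC F set_integrable_subset[OF int]) auto
    then show ?case by simp
  qed
  ultimately show ?thesis by (rule Lim_transform_eventually)
qed

text \<open>An interior point \<open>c\<close> splits the interval; \<open>F c\<close> cancels, so
  only the limits at the two ends remain.\<close>

lemma FTC_tendsto_Ioo:
  fixes F f :: "real \<Rightarrow> real"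
  assumes "a < b" and F: "\<And>z. z \<in> {a<..<b} \<Longrightarrow> (F has_real_derivative f z) (at z)"
    and int: "set_integrable lborel {a<..<b} f"
  obtains A B where "(F \<longlongrightarrow> A) (at_right a)" "(F \<longlongrightarrow> B) (at_left b)"
    "(LINT z:{a<..<b}|lborel. f z) = B - A"
proof -
  define c where "c = (a + b) / 2"
  have c: "a < c" "c < b" using \<open>a < b\<close> by (auto simp: c_def)
  have i1: "set_integrable lborel {a<..c} f" and i2: "set_integrable lborel {c..<b} f"
    using c by (auto intro!: set_integrable_subset[OF int])
  have i3: "set_integrable lborel {c<..<b} f"
    using c by (auto intro!: set_integrable_subset[OF int])
  have "{a<..<b} = {a<..c} \<union> {c<..<b}" "{a<..c} \<inter> {c<..<b} = {}" using c by auto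
  then have "(LINT z:{a<..<b}|lborel. f z) = (LINT z:{a<..c}|lborel. f z) + (LINT z:{c<..<b}|lborel. f z)"
    using set_integral_Un[OF _ i1 i3] by simp
  also have "(LINT z:{c<..<b}|lborel. f z) = (LINT z:{c..<b}|lborel. f z)"
  proof (rule set_integral_cong_set)
    show "AE x in lborel. (x \<in> {c..<b}) = (x \<in> {c<..<b})"
      using AE_lborel_singleton[of c] c by (auto elim!: eventually_mono)
  qed (use i2 i3 in \<open>auto simp: set_integrable_def set_borel_measurable_def\<close>)
  finally have "(LINT z:{a<..<b}|lborel. f z) =
    (F c + (LINT z:{c..<b}|lborel. f z)) - (F c - (LINT z:{a<..c}|lborel. f z))" by simp
  moreover have "(F \<longlongrightarrow> F c - (LINT z:{a<..c}|lborel. f z)) (at_right a)"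
    using c i1 by (intro FTC_tendsto_at_right F) auto
  moreover have "(F \<longlongrightarrow> F c + (LINT z:{c..<b}|lborel. f z)) (at_left b)"
    using c i2 by (intro FTC_tendsto_at_left F) auto
  ultimately show ?thesis using that by blast
qed

lemma FTC_tendsto_Ioi:
  fixes F f :: "real \<Rightarrow> real"
  assumes F: "\<And>z. z > a \<Longrightarrow> (F has_real_derivative f z) (at z)"
    and int: "set_integrable lborel {a<..} f"
  obtains A B where "(F \<longlongrightarrow> A) (at_right a)" "(F \<longlongrightarrow> B) at_top"
    "(LINT z:{a<..}|lborel. f z) = B - A"
proof -
  define c where "c = a + 1"
  have c: "a < c" by (auto simp: c_def)
  have i1: "set_integrable lborel {a<..c} f" and i2: "set_integrable lborel {c..} f"
    using c by (auto intro!: set_integrable_subset[OF int])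
  have i3: "set_integrable lborel {c<..} f"
    using c by (auto intro!: set_integrable_subset[OF int])
  have "{a<..} = {a<..c} \<union> {c<..}" "{a<..c} \<inter> {c<..} = {}" using c by auto
  then have "(LINT z:{a<..}|lborel. f z) = (LINT z:{a<..c}|lborel. f z) + (LINT z:{c<..}|lborel. f z)"
    using set_integral_Un[OF _ i1 i3] by simp
  also have "(LINT z:{c<..}|lborel. f z) = (LINT z:{c..}|lborel. f z)"
  proof (rule set_integral_cong_set)
    show "AE x in lborel. (x \<in> {c..}) = (x \<in> {c<..})"
      using AE_lborel_singleton[of c] c by (auto elim!: eventually_mono)
  qed (use i2 i3 in \<open>auto simp: set_integrable_def set_borel_measurable_def\<close>)
  finally have "(LINT z:{a<..}|lborel. f z) =
    (F c + (LINT z:{c..}|lborel. f z)) - (F c - (LINT z:{a<..c}|lborel. f z))" by simp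
  moreover have "(F \<longlongrightarrow> F c - (LINT z:{a<..c}|lborel. f z)) (at_right a)"
    using c i1 by (intro FTC_tendsto_at_right F) auto
  moreover have "(F \<longlongrightarrow> F c + (LINT z:{c..}|lborel. f z)) at_top"
    using c i2 by (intro FTC_tendsto_at_top F) auto
  ultimately show ?thesis using that by blast
qed

section \<open>Splitting an integral over the components of an open set\<close>

lemma set_integral_Union_zero:
  fixes f :: "'a \<Rightarrow> real"
  assumes "countable \<C>" "disjoint \<C>" "\<And>c. c \<in> \<C> \<Longrightarrow> c \<in> sets M"
    and int: "set_integrable M (\<Union>\<C>) f"
    and zero: "\<And>c. c \<in> \<C> \<Longrightarrow> (LINT x:c|M. f x) = 0"
  shows "(LINT x:\<Union>\<C>|M. f x) = 0"
proof -
  \<comment> \<open>Indices outside the range of \<open>to_nat_on\<close> get the empty set: there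
    \<open>from_nat_into\<close> returns some member of the family again, which would spoil
    disjointness.\<close>
  define A where "A i = (if i \<in> to_nat_on \<C> ` \<C> then from_nat_into \<C> i else {})" for i
  have A: "A i = {} \<or> A i \<in> \<C>" for i
    using \<open>countable \<C>\<close> by (auto simp: A_def)
  have U: "(\<Union>i. A i) = \<Union>\<C>"
  proof
    show "\<Union>\<C> \<subseteq> (\<Union>i. A i)"
    proof
      fix x assume "x \<in> \<Union>\<C>"
      then obtain c where c: "c \<in> \<C>" "x \<in> c" by auto
      then have "A (to_nat_on \<C> c) = c" using \<open>countable \<C>\<close> by (auto simp: A_def)
      then show "x \<in> (\<Union>i. A i)" using c by auto
    qed
  qed (use A in blast)
  have "(LINT x:(\<Union>i. A i)|M. f x) = (\<Sum>i. (LINT x:(A i)|M. f x))"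
  proof (rule lebesgue_integral_countable_add)
    show "A i \<in> sets M" for i using A[of i] assms(3) by auto
    show "A i \<inter> A j = {}" if "i \<noteq> j" for i j
    proof (cases "A i = {} \<or> A j = {}")
      case False
      then obtain c d where "c \<in> \<C>" "i = to_nat_on \<C> c" "d \<in> \<C>" "j = to_nat_on \<C> d"
        by (auto simp: A_def split: if_splits)
      moreover from this have "A i = c" "A j = d" using \<open>countable \<C>\<close> by (auto simp: A_def)
      ultimately show ?thesis using that \<open>disjoint \<C>\<close> by (auto dest: disjointD)
    qed auto
    show "set_integrable M (\<Union>i. A i) f" using int U by simp
  qed
  moreover have "(LINT x:(A i)|M. f x) = 0" for i
    using A[of i] zero[of "A i"] by (auto simp: set_lebesgue_integral_def)
  ultimately show ?thesis using U by simp
qed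

text \<open>The ends are \<open>Inf c\<close> and \<open>Sup c\<close>: openness keeps them out of
  \<open>c\<close>, and connectedness fills in everything between.\<close>

lemma open_connected_real_bdd_below_cases:
  fixes c :: "real set"
  assumes "open c" "connected c" "c \<noteq> {}" "bdd_below c"
  obtains a b where "a < b" "c = {a<..<b}" | a where "c = {a<..}"
proof -
  have lo: "Inf c < x" if "x \<in> c" for x
  proof -
    obtain y where "y < x" "{y<..x} \<subseteq> c" using open_left[of c x "x - 1"] assms(1) \<open>x \<in> c\<close> by auto
    then have "(x + y) / 2 \<in> c" by auto
    then have "Inf c \<le> (x + y) / 2" by (intro cInf_lower assms)
    then show ?thesis using \<open>y < x\<close> by simp
  qed
  have hi: "x < Sup c" if "x \<in> c" "bdd_above c" for x
  proof -
    obtain y where "x < y" "{x..<y} \<subseteq> c" using open_right[of c x "x + 1"] assms(1) \<open>x \<in> c\<close> by auto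
    then have "(x + y) / 2 \<in> c" by auto
    then have "(x + y) / 2 \<le> Sup c" by (intro cSup_upper that)
    then show ?thesis using \<open>x < y\<close> by simp
  qed
  have mid: "x \<in> c" if "Inf c < x" "x < y" "y \<in> c" for x y
  proof -
    obtain z where "z \<in> c" "z < x" using \<open>Inf c < x\<close> assms by (auto simp: cInf_less_iff)
    then show ?thesis using connected_contains_Ioo[OF \<open>connected c\<close> \<open>z \<in> c\<close> \<open>y \<in> c\<close>] that by auto
  qed
  show ?thesis
  proof (cases "bdd_above c")
    case True
    have "c = {Inf c<..<Sup c}"
      using lo hi[OF _ True] mid less_cSup_iff[OF \<open>c \<noteq> {}\<close> True] by (auto; blast)
    moreover have "Inf c < Sup c" using \<open>c \<noteq> {}\<close> lo hi[OF _ True] by (meson ex_in_conv less_trans)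
    ultimately show ?thesis using that(1) by blast
  next
    case False
    have "c = {Inf c<..}"
    proof (intro equalityI subsetI)
      fix x assume "x \<in> {Inf c<..}"
      moreover obtain y where "y \<in> c" "x < y" using False by (auto simp: bdd_above_def not_le)
      ultimately show "x \<in> c" using mid by auto
    qed (use lo in auto)
    then show ?thesis using that(2) by blast
  qed
qed

text \<open>
  Covers \<open>at_right\<close>, \<open>at_left\<close> and \<open>at_top\<close> at once: what holds eventually at the end \<open>F\<close>
  of \<open>c\<close> holds on a subinterval of \<open>c\<close> reaching up to that end.
\<close>

definition interval_end :: "real set \<Rightarrow> real filter \<Rightarrow> bool" where
  "interval_end c F \<longleftrightarrow> F \<noteq> bot \<and>
     (\<forall>R. eventually R F \<longrightarrow>
        (\<exists>I. open I \<and> is_interval I \<and> I \<noteq> {} \<and> I \<subseteq> c \<and> (\<forall>x\<in>I. R x) \<and> eventually (\<lambda>x. x \<in> I) F))"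

lemma interval_end_at_right:
  assumes "a < b" "{a<..<b} \<subseteq> c" shows "interval_end c (at_right a)"
  unfolding interval_end_def
proof (intro conjI allI impI)
  fix R assume "eventually R (at_right a)"
  then obtain d where d: "a < d" "\<And>x. a < x \<Longrightarrow> x < d \<Longrightarrow> R x"
    by (auto simp: eventually_at_right_field)
  show "\<exists>I. open I \<and> is_interval I \<and> I \<noteq> {} \<and> I \<subseteq> c \<and> (\<forall>x\<in>I. R x) \<and> eventually (\<lambda>x. x \<in> I) (at_right a)"
    using assms d eventually_at_right_real[of a "min b d"]
    by (intro exI[of _ "{a<..<min b d}"]) (auto simp: is_interval_oo)
qed simp

lemma interval_end_at_left:
  assumes "a < b" "{a<..<b} \<subseteq> c" shows "interval_end c (at_left b)"
  unfolding interval_end_def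
proof (intro conjI allI impI)
  fix R assume "eventually R (at_left b)"
  then obtain d where d: "d < b" "\<And>x. d < x \<Longrightarrow> x < b \<Longrightarrow> R x"
    by (auto simp: eventually_at_left_field)
  show "\<exists>I. open I \<and> is_interval I \<and> I \<noteq> {} \<and> I \<subseteq> c \<and> (\<forall>x\<in>I. R x) \<and> eventually (\<lambda>x. x \<in> I) (at_left b)"
    using assms d eventually_at_left_real[of "max a d" b]
    by (intro exI[of _ "{max a d<..<b}"]) (auto simp: is_interval_oo)
qed simp

lemma interval_end_at_top:
  assumes "{a<..} \<subseteq> c" shows "interval_end c at_top"
  unfolding interval_end_def
proof (intro conjI allI impI)
  fix R assume "eventually R (at_top :: real filter)"
  then obtain d where d: "\<And>x. d \<le> x \<Longrightarrow> R x"
    by (auto simp: eventually_at_top_linorder)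
  show "\<exists>I. open I \<and> is_interval I \<and> I \<noteq> {} \<and> I \<subseteq> c \<and> (\<forall>x\<in>I. R x) \<and> eventually (\<lambda>x. x \<in> I) at_top"
    using assms d eventually_gt_at_top[of "max a d"]
    by (intro exI[of _ "{max a d<..}"]) (auto simp: is_interval_oi)
qed simp

section \<open>Vanishing of the boundary terms of the second density\<close>

text \<open>The point of the Gronwall bound is to keep \<open>p / q\<close> above a positive
  constant, so that \<open>g * p\<close>, being \<open>p / q\<close> times \<open>g * q\<close>,
  cannot tend to 0 unless \<open>g * q\<close> does.\<close>

lemma flux_limit_zero:
  fixes p q g r1 r2 :: "real \<Rightarrow> real"
  assumes F: "interval_end c F"
    and p: "\<And>x. x \<in> c \<Longrightarrow> (p has_real_derivative r1 x * p x) (at x)"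
    and q: "\<And>x. x \<in> c \<Longrightarrow> (q has_real_derivative r2 x * q x) (at x)"
    and nonneg: "\<And>x. 0 \<le> p x" "\<And>x. 0 \<le> q x"
    and dense: "c \<subseteq> closure {x. 0 < p x}"
    and int: "set_integrable lborel c (\<lambda>x. q x * (g x * (r1 x - r2 x)))"
    and u: "((\<lambda>x. g x * p x) \<longlongrightarrow> 0) F"
    and v: "((\<lambda>x. g x * q x) \<longlongrightarrow> L) F"
  shows "L = 0"
proof (rule ccontr)
  assume "L \<noteq> 0"
  have "\<forall>\<^sub>F x in F. dist (g x * q x) L < \<bar>L\<bar> / 2"
    using v \<open>L \<noteq> 0\<close> by (intro tendstoD) auto
  then have "\<forall>\<^sub>F x in F. \<bar>L\<bar> / 2 \<le> \<bar>g x * q x\<bar>"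
    by eventually_elim (auto simp: dist_real_def abs_if split: if_splits)
  then obtain I where I: "open I" "is_interval I" "I \<noteq> {}" "I \<subseteq> c"
    "\<And>x. x \<in> I \<Longrightarrow> \<bar>L\<bar> / 2 \<le> \<bar>g x * q x\<bar>" "eventually (\<lambda>x. x \<in> I) F"
    using F unfolding interval_end_def by blast
  have "F \<noteq> bot" using F by (simp add: interval_end_def)
  have qpos: "0 < q x" if "x \<in> I" for x
    using I(5)[OF that] nonneg(2)[of x] \<open>L \<noteq> 0\<close> by (cases "q x = 0") auto
  \<comment> \<open>At this stage \<open>p\<close> may still have zeros in \<open>I\<close>. One
    point where it is positive is enough, since the comparison carries a lower bound for
    \<open>p / q\<close> from there to all of \<open>I\<close>.\<close>
  obtain x0 where x0: "x0 \<in> I" "0 < p x0"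
    using dense I(1,3,4) open_Int_closure_eq_empty[of I "{x. 0 < p x}"] by blast
  \<comment> \<open>On \<open>I\<close> the factor \<open>2 / |L| * |g x * q x|\<close> is at least
    1, so \<open>\<psi>\<close> dominates \<open>|r1 - r2|\<close> while being a multiple of an
    integrable function. As \<open>C\<close> is the integral over all of \<open>I\<close>, the
    resulting bound does not depend on the point compared.\<close>
  define \<psi> where "\<psi> x = 2 / \<bar>L\<bar> * \<bar>q x * (g x * (r1 x - r2 x))\<bar>" for x
  define C where "C = (LINT x:I|lborel. \<psi> x)"
  have int\<psi>: "set_integrable lborel A \<psi>" if "A \<subseteq> I" "A \<in> sets lborel" for A
  proof (rule set_integrable_subset[OF _ that(2)])
    show "set_integrable lborel c \<psi>"
      unfolding \<psi>_def using int by (intro set_integrable_mult_right set_integrable_abs) auto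
    show "A \<subseteq> c" using that I(4) by auto
  qed
  define s where "s x = p x / q x" for x
  have Gron: "s x0 \<le> s y * exp C" if "y \<in> I" for y
  proof -
    define a b where "a = min x0 y" and "b = max x0 y"
    have ab: "a \<le> b" "a \<in> I" "b \<in> I" using that x0 by (auto simp: a_def b_def min_def max_def)
    have sub: "{a..b} \<subseteq> I" using mem_is_interval_1_I[OF I(2) ab(2,3)] by auto
    have i: "set_integrable lborel {a..b} \<psi>" by (rule int\<psi>) (use sub in auto)
    have le: "(LINT x:{a..b}|lborel. \<psi> x) \<le> C"
      unfolding C_def set_lebesgue_integral_def
      using i int\<psi>[of I] I(1) sub unfolding set_integrable_def
      by (intro integral_mono) (auto simp: \<psi>_def indicator_def)
    have d: "(s has_real_derivative (r1 z - r2 z) * s z) (at z within {a..b})" if "z \<in> {a..b}" for z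
    proof -
      have "z \<in> I" using sub that by auto
      then show ?thesis unfolding s_def using qpos[of z] I(4)
        by (auto intro!: derivative_eq_intros has_field_derivative_at_within[OF p] has_field_derivative_at_within[OF q]
              simp: field_simps power2_eq_square)
    qed
    have bd: "\<bar>(r1 z - r2 z) * s z\<bar> \<le> \<psi> z * s z" if "z \<in> {a..b}" for z
    proof -
      have z: "z \<in> I" using sub that by auto
      have "1 \<le> 2 / \<bar>L\<bar> * \<bar>g z * q z\<bar>" using I(5)[OF z] \<open>L \<noteq> 0\<close> by (simp add: field_simps)
      from mult_right_mono[OF this, of "\<bar>r1 z - r2 z\<bar>"]
      have "\<bar>r1 z - r2 z\<bar> \<le> (2 / \<bar>L\<bar> * \<bar>g z * q z\<bar>) * \<bar>r1 z - r2 z\<bar>"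
        by simp
      also have "\<dots> = \<psi> z" by (simp add: \<psi>_def abs_mult)
      finally have "\<bar>r1 z - r2 z\<bar> \<le> \<psi> z" .
      moreover have "0 \<le> s z" using nonneg by (simp add: s_def)
      ultimately show ?thesis by (simp add: abs_mult mult_right_mono)
    qed
    have nn: "0 \<le> s z" "0 \<le> \<psi> z" for z using nonneg by (auto simp: s_def \<psi>_def)
    note G = gronwall_comparable[OF ab(1) d nn(1) bd set_borel_integral_eq_integral(1)[OF i] nn(2)]
    have e: "s z * exp (integral {a..b} \<psi>) \<le> s z * exp C" for z
      using le nn(1)[of z] set_borel_integral_eq_integral(2)[OF i] by (intro mult_left_mono) auto
    show ?thesis
      using G e[of y] by (cases "x0 \<le> y") (auto simp: a_def b_def min_def max_def intro: order.trans)
  qed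
  define \<kappa> where "\<kappa> = s x0 * exp (- C)"
  have "\<kappa> > 0" using x0 qpos[of x0] by (simp add: \<kappa>_def s_def)
  have "\<forall>\<^sub>F x in F. \<kappa> * (\<bar>L\<bar> / 2) \<le> \<bar>g x * p x\<bar>"
    using I(6)
  proof eventually_elim
    case (elim x)
    have "\<kappa> \<le> s x" using Gron[OF elim] by (simp add: \<kappa>_def exp_minus field_simps)
    then have "\<kappa> * (\<bar>L\<bar> / 2) \<le> s x * \<bar>g x * q x\<bar>"
      using I(5)[OF elim] \<open>\<kappa> > 0\<close> by (intro mult_mono) auto
    also have "\<dots> = \<bar>g x * p x\<bar>"
      using qpos[OF elim] nonneg(1)[of x] by (simp add: s_def abs_mult)
    finally show ?case .
  qed
  then have "\<kappa> * (\<bar>L\<bar> / 2) \<le> \<bar>0\<bar>"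
    using tendsto_lowerbound[OF tendsto_rabs[OF u] _ \<open>F \<noteq> bot\<close>] by blast
  then show False using \<open>\<kappa> > 0\<close> \<open>L \<noteq> 0\<close> by (simp add: mult_le_0_iff)
qed

text \<open>The difference of the two integrands is the derivative of \<open>g * q\<close>. It
  integrates to 0 over each component because \<open>flux_limit_zero\<close> kills both end limits,
  and there are countably many components.\<close>

lemma flux_identity:
  fixes p q g k r1 r2 :: "real \<Rightarrow> real"
  assumes S: "open S" "bdd_below S"
    and p: "\<And>x. x \<in> S \<Longrightarrow> (p has_real_derivative r1 x * p x) (at x)"
    and q: "\<And>x. x \<in> S \<Longrightarrow> (q has_real_derivative r2 x * q x) (at x)"
    and nonneg: "\<And>x. 0 \<le> p x" "\<And>x. 0 \<le> q x"
    and dense: "S \<subseteq> closure {x. 0 < p x}"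
    and g: "\<And>x. x \<in> S \<Longrightarrow> (g has_real_derivative k x - r1 x * g x) (at x)"
    and pk: "set_integrable lborel S (\<lambda>x. p x * k x)" "(LINT x:S|lborel. p x * k x) = 0"
    and qk: "set_integrable lborel S (\<lambda>x. q x * k x)"
    and qd: "set_integrable lborel S (\<lambda>x. q x * (g x * (r1 x - r2 x)))"
    and bdry: "\<And>a. a \<in> frontier S \<Longrightarrow> ((\<lambda>x. g x * p x) \<longlongrightarrow> 0) (at a within S)"
  shows "(LINT x:S|lborel. q x * k x) = (LINT x:S|lborel. q x * (g x * (r1 x - r2 x)))"
proof -
  define \<phi> where "\<phi> x = q x * k x - q x * (g x * (r1 x - r2 x))" for x
  have \<phi>: "set_integrable lborel S \<phi>"
    unfolding \<phi>_def using qk qd by (rule set_integral_diff)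
  have u': "((\<lambda>x. g x * p x) has_real_derivative p x * k x) (at x)" if "x \<in> S" for x
    using that by (auto intro!: derivative_eq_intros p g simp: algebra_simps)
  have v': "((\<lambda>x. g x * q x) has_real_derivative \<phi> x) (at x)" if "x \<in> S" for x
    unfolding \<phi>_def using that by (auto intro!: derivative_eq_intros q g simp: algebra_simps)

  let ?\<C> = "components S"
  have C: "open c" "connected c" "c \<noteq> {}" "c \<subseteq> S" "bdd_below c" "c \<in> sets lborel" if "c \<in> ?\<C>" for c
    using open_components[OF S(1) that] that in_components_subset[OF that] S(2)
    by (auto intro: in_components_connected bdd_below_mono dest: in_components_nonempty)
  have disj: "disjoint ?\<C>"
    using pairwise_disjoint_components[of S] by (simp add: disjoint_def pairwise_def disjnt_def)
  have count: "countable ?\<C>"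
    by (rule countable_disjoint_open_subsets) (use C disj in auto)
  have lim0: "L = 0" if "c \<in> ?\<C>" "interval_end c F" "((\<lambda>x. g x * p x) \<longlongrightarrow> 0) F" "((\<lambda>x. g x * q x) \<longlongrightarrow> L) F"
    for c F L
    using that C(4)[OF that(1)] dense
    by (intro flux_limit_zero[OF that(2) p q nonneg _ _ that(3,4)] set_integrable_subset[OF qd] C) auto
  have fr: "a \<in> frontier S" if "c \<in> ?\<C>" "a \<in> frontier c" for a c
    using frontier_of_components_subset[OF that(1)] that(2) by auto

  \<comment> \<open>The integral of \<open>p * k\<close> is recorded together with that of
    \<open>\<phi>\<close>, since it enters the treatment of the unbounded component.\<close>
  have Ioo: "(LINT x:c|lborel. p x * k x) = 0 \<and> (LINT x:c|lborel. \<phi> x) = 0"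
    if c: "c \<in> ?\<C>" "c = {a<..<b}" "a < b" for a b c
  proof -
    have i: "set_integrable lborel {a<..<b} (\<lambda>x. p x * k x)" "set_integrable lborel {a<..<b} \<phi>"
      using C[OF c(1)] c(2) by (auto intro: set_integrable_subset[OF pk(1)] set_integrable_subset[OF \<phi>])
    have sub: "z \<in> S" if "z \<in> {a<..<b}" for z using C(4)[OF c(1)] c(2) that by auto
    have ab: "a \<in> frontier S" "b \<in> frontier S"
      using c fr[OF c(1), of a] fr[OF c(1), of b] unfolding frontier_def[of c] by (auto simp: interior_open)
    have sub': "{a<..<b} \<subseteq> S" using sub by auto
    \<comment> \<open>A frontier point can be the end of two adjacent components; restricting the
      limit within \<open>S\<close> to this component makes it one-sided.\<close>
    have at_ends: "at a within {a<..<b} = at_right a" "at b within {a<..<b} = at_left b"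
      using \<open>a < b\<close>
      by (auto intro!: at_within_nhd[of a "{..<b}"] at_within_nhd[of b "{a<..}"])
    have ua: "((\<lambda>x. g x * p x) \<longlongrightarrow> 0) (at_right a)"
      using tendsto_within_subset[OF bdry[OF ab(1)] sub'] at_ends by simp
    have ub: "((\<lambda>x. g x * p x) \<longlongrightarrow> 0) (at_left b)"
      using tendsto_within_subset[OF bdry[OF ab(2)] sub'] at_ends by simp
    obtain A B where AB: "((\<lambda>x. g x * p x) \<longlongrightarrow> A) (at_right a)" "((\<lambda>x. g x * p x) \<longlongrightarrow> B) (at_left b)"
      "(LINT x:{a<..<b}|lborel. p x * k x) = B - A"
      using FTC_tendsto_Ioo[OF \<open>a < b\<close> u'[OF sub] i(1)] .
    have "A = 0" "B = 0"
      using tendsto_unique[OF _ AB(1) ua] tendsto_unique[OF _ AB(2) ub] by auto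
    moreover obtain A' B' where AB': "((\<lambda>x. g x * q x) \<longlongrightarrow> A') (at_right a)" "((\<lambda>x. g x * q x) \<longlongrightarrow> B') (at_left b)"
      "(LINT x:{a<..<b}|lborel. \<phi> x) = B' - A'"
      using FTC_tendsto_Ioo[OF \<open>a < b\<close> v'[OF sub] i(2)] .
    have "A' = 0" "B' = 0"
      using lim0[OF c(1) interval_end_at_right ua AB'(1)] lim0[OF c(1) interval_end_at_left ub AB'(2)] c
      by auto
    ultimately show ?thesis using AB(3) AB'(3) c(2) by simp
  qed
  have Ioi: "(LINT x:c|lborel. \<phi> x) = 0" if c: "c \<in> ?\<C>" "c = {a<..}" for a c
  proof -
    have i: "set_integrable lborel {a<..} (\<lambda>x. p x * k x)" "set_integrable lborel {a<..} \<phi>"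
      using C[OF c(1)] c(2) by (auto intro: set_integrable_subset[OF pk(1)] set_integrable_subset[OF \<phi>])
    have sub: "z \<in> S" if "a < z" for z using C(4)[OF c(1)] c(2) that by auto
    have sub': "{a<..} \<subseteq> S" using sub by auto
    have "a \<in> frontier S" using c fr[OF c(1), of a] unfolding frontier_def[of c] by (auto simp: interior_open)
    from tendsto_within_subset[OF bdry[OF this] sub']
    have ua: "((\<lambda>x. g x * p x) \<longlongrightarrow> 0) (at_right a)" .
    obtain A B where AB: "((\<lambda>x. g x * p x) \<longlongrightarrow> A) (at_right a)" "((\<lambda>x. g x * p x) \<longlongrightarrow> B) at_top"
      "(LINT x:{a<..}|lborel. p x * k x) = B - A"
      using FTC_tendsto_Ioi[OF u'[OF sub] i(1)] .
    have "A = 0" using tendsto_unique[OF _ AB(1) ua] by auto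
    \<comment> \<open>No condition is imposed on \<open>g * p\<close> at infinity. It vanishes there since the integrals of its
      derivative over \<open>S\<close> and over the bounded components are 0.\<close>
    have bounded: "(LINT x:d|lborel. p x * k x) = 0" if d: "d \<in> ?\<C> - {c}" for d
    proof -
      have "d \<in> ?\<C>" using d by simp
      have "d \<inter> c = {}" using d c disj by (auto dest: disjointD)
      show ?thesis
      proof (rule open_connected_real_bdd_below_cases[OF C(1,2,3,5)[OF \<open>d \<in> ?\<C>\<close>]])
        show ?thesis if "x < y" "d = {x<..<y}" for x y
          using Ioo[OF \<open>d \<in> ?\<C>\<close> that(2,1)] by simp
        \<comment> \<open>Two rays pointing to the right always meet, so \<open>c\<close> is the
          only unbounded component.\<close>
        show ?thesis if "d = {x<..}" for x
        proof -
          have "max x a + 1 \<in> d \<inter> c" using that c(2) by (simp add: max_def)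
          then show ?thesis using \<open>d \<inter> c = {}\<close> by simp
        qed
      qed
    qed
    have "\<Union>(?\<C> - {c}) \<subseteq> S" using C(4) by auto
    moreover have "\<Union>(?\<C> - {c}) \<in> sets lborel" using count C(6) by (auto intro!: sets.countable_Union)
    ultimately have i': "set_integrable lborel (\<Union>(?\<C> - {c})) (\<lambda>x. p x * k x)"
      by (intro set_integrable_subset[OF pk(1)])
    have "(LINT x:\<Union>(?\<C> - {c})|lborel. p x * k x) = 0"
      using count disj C(6) i' bounded
      by (intro set_integral_Union_zero) (auto simp: disjoint_def)
    moreover have "S = \<Union>(?\<C> - {c}) \<union> {a<..}"
    proof -
      have "\<Union>?\<C> = \<Union>(?\<C> - {c}) \<union> c" using c(1) by blast
      then show ?thesis using c(2) by simp
    qed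
    moreover have "\<Union>(?\<C> - {c}) \<inter> {a<..} = {}"
      using c(1) disj unfolding c(2)[symmetric] disjoint_def by blast
    ultimately have "(LINT x:S|lborel. p x * k x) = (LINT x:{a<..}|lborel. p x * k x)"
      using set_integral_Un[OF _ i' i(1)] by simp
    then have "B = 0" using AB(3) \<open>A = 0\<close> pk(2) by simp
    obtain A' B' where AB': "((\<lambda>x. g x * q x) \<longlongrightarrow> A') (at_right a)" "((\<lambda>x. g x * q x) \<longlongrightarrow> B') at_top"
      "(LINT x:{a<..}|lborel. \<phi> x) = B' - A'"
      using FTC_tendsto_Ioi[OF v'[OF sub] i(2)] .
    have "interval_end c (at_right a)"
      by (rule interval_end_at_right[of a "a + 1"]) (use c in auto)
    then have "A' = 0" using lim0[OF c(1) _ ua AB'(1)] by simp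
    moreover have "interval_end c at_top"
      by (rule interval_end_at_top[of a]) (use c in auto)
    then have "B' = 0" using lim0[OF c(1) _ _ AB'(2)] AB(2) \<open>B = 0\<close> by simp
    ultimately show ?thesis using AB'(3) c(2) by simp
  qed
  have "(LINT x:c|lborel. \<phi> x) = 0" if "c \<in> ?\<C>" for c
    using open_connected_real_bdd_below_cases[OF C(1,2,3,5)[OF that]] Ioo[OF that] Ioi[OF that]
    by metis
  then have "(LINT x:\<Union>?\<C>|lborel. \<phi> x) = 0"
    using count disj C(6) \<phi> Union_components[of S] by (intro set_integral_Union_zero) auto
  then show ?thesis
    using set_integral_diff(2)[OF qk qd] Union_components[of S] by (simp add: \<phi>_def)
qed

section \<open>The flux identity on the natural numbers\<close>

text \<open>Telescoping gives \<open>p n * g n\<close> the limit 0 and \<open>q n * g n\<close> the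
  limit \<open>A - B\<close>. If the latter were nonzero, the relative increments of
  \<open>q / p\<close> would be summable, so \<open>q / p\<close> would be bounded and
  \<open>q n * g n\<close> would tend to 0 as well.\<close>

lemma flux_identity_nat:
  fixes p q g k d :: "nat \<Rightarrow> real"
  assumes init: "p 0 = 0" "q 0 = 0" and nonneg: "\<And>n. 0 \<le> p n" "\<And>n. 0 \<le> q n"
    and supp: "\<And>n. 0 < q n \<Longrightarrow> 0 < p n"
    and u: "\<And>n. p (Suc n) * g (Suc n) - p n * g n = p (Suc n) * k (Suc n)"
    and v: "\<And>n. q (Suc n) * g (Suc n) - q n * g n = q (Suc n) * k (Suc n) - q (Suc n) * d (Suc n)"
    and d: "\<And>n. 0 < q (Suc n) \<Longrightarrow> d (Suc n) = g n * (q n / q (Suc n) - p n / p (Suc n))"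
    and pk: "(\<lambda>n. p n * k n) sums 0" and qk: "(\<lambda>n. q n * k n) sums A"
    and qd: "(\<lambda>n. q n * d n) sums B" "summable (\<lambda>n. \<bar>q n * d n\<bar>)"
  shows "A = B"
proof (rule ccontr)
  define L where "L = A - B"
  assume "A \<noteq> B"
  then have "L \<noteq> 0" by (simp add: L_def)
  \<comment> \<open>The initial masses at index 0 vanish, so no boundary term appears on the left of
    the telescoping sum.\<close>
  have "p n * g n = (\<Sum>j\<le>n. p j * k j)" for n
    by (induction n) (use init u in \<open>auto simp: algebra_simps\<close>)
  then have u0: "(\<lambda>n. p n * g n) \<longlonglongrightarrow> 0"
    using pk by (simp add: sums_def_le)
  have "q n * g n = (\<Sum>j\<le>n. q j * k j - q j * d j)" for n
    by (induction n) (use init v in \<open>auto simp: algebra_simps\<close>)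
  then have vL: "(\<lambda>n. q n * g n) \<longlonglongrightarrow> L"
    using sums_diff[OF qk qd(1)] by (simp add: sums_def_le L_def)
  have "\<forall>\<^sub>F n in sequentially. dist (q n * g n) L < \<bar>L\<bar> / 2"
    using vL \<open>L \<noteq> 0\<close> by (intro tendstoD) auto
  then have "\<forall>\<^sub>F n in sequentially. \<bar>L\<bar> / 2 \<le> \<bar>q n * g n\<bar>"
    by eventually_elim (auto simp: dist_real_def abs_if split: if_splits)
  then obtain n0 where n0: "\<And>n. n \<ge> n0 \<Longrightarrow> \<bar>L\<bar> / 2 \<le> \<bar>q n * g n\<bar>"
    by (auto simp: eventually_sequentially)
  have qpos: "0 < q n" if "n \<ge> n0" for n
    using n0[OF that] nonneg(2)[of n] \<open>L \<noteq> 0\<close> by (cases "q n = 0") auto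
  define e where "e n = 2 / \<bar>L\<bar> * \<bar>q n * d n\<bar>" for n
  have e: "0 \<le> e n" "summable e" for n
    unfolding e_def[abs_def] using qd(2) by (auto intro!: summable_mult)
  \<comment> \<open>The quotient is the reciprocal of the one in the continuous case: here
    \<open>supp\<close> makes \<open>p\<close> positive wherever \<open>q\<close> is, and an upper
    bound for \<open>q / p\<close> is all that is required.\<close>
  define r where "r n = q n / p n" for n
  have step: "r (Suc n) \<le> r n * exp (e (Suc n))" if "n \<ge> n0" for n
  proof -
    have pos: "0 < q n" "0 < q (Suc n)" "0 < p n" "0 < p (Suc n)"
      using that by (auto intro!: qpos supp)
    \<comment> \<open>The discrete substitute for the logarithmic derivative: the difference of the
      scores is the relative increment of \<open>r\<close>, weighted by \<open>q n * g n\<close>,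
      which is at least \<open>|L| / 2\<close> in absolute value.\<close>
    have "q (Suc n) * d (Suc n) = (q n * g n) * (1 - r (Suc n) / r n)"
      using pos by (simp add: d r_def field_simps)
    then have "e (Suc n) = (2 / \<bar>L\<bar> * \<bar>q n * g n\<bar>) * \<bar>1 - r (Suc n) / r n\<bar>"
      by (simp add: e_def abs_mult)
    moreover have "1 \<le> 2 / \<bar>L\<bar> * \<bar>q n * g n\<bar>"
      using n0[OF that] \<open>L \<noteq> 0\<close> by (simp add: field_simps)
    from mult_right_mono[OF this, of "\<bar>1 - r (Suc n) / r n\<bar>"]
    have "\<bar>1 - r (Suc n) / r n\<bar> \<le> (2 / \<bar>L\<bar> * \<bar>q n * g n\<bar>) * \<bar>1 - r (Suc n) / r n\<bar>" by simp
    ultimately have "r (Suc n) / r n \<le> 1 + e (Suc n)" by linarith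
    also have "\<dots> \<le> exp (e (Suc n))" by (rule exp_ge_add_one_self)
    finally show ?thesis using pos by (simp add: r_def field_simps)
  qed
  have r_le: "r n \<le> r n0 * exp (\<Sum>j\<in>{n0..<n}. e (Suc j))" if "n \<ge> n0" for n
    using that
  proof (induction n rule: nat_induct_at_least)
    case (Suc n)
    have "r (Suc n) \<le> r n * exp (e (Suc n))" by (rule step[OF Suc.hyps])
    also have "\<dots> \<le> (r n0 * exp (\<Sum>j\<in>{n0..<n}. e (Suc j))) * exp (e (Suc n))"
      by (intro mult_right_mono Suc.IH) simp
    finally show ?case using Suc.hyps by (simp add: exp_add)
  qed simp
  define K where "K = r n0 * exp (suminf (\<lambda>j. e (Suc j)))"
  have rK: "r n \<le> K" if "n \<ge> n0" for n
  proof -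
    have "(\<Sum>j\<in>{n0..<n}. e (Suc j)) \<le> suminf (\<lambda>j. e (Suc j))"
      using e by (intro sum_le_suminf) (auto simp: summable_Suc_iff)
    then have "r n0 * exp (\<Sum>j\<in>{n0..<n}. e (Suc j)) \<le> K"
      unfolding K_def using nonneg by (intro mult_left_mono) (auto simp: r_def)
    then show ?thesis using r_le[OF that] by simp
  qed
  have "\<forall>\<^sub>F n in sequentially. \<bar>q n * g n\<bar> \<le> K * \<bar>p n * g n\<bar>"
    using eventually_ge_at_top[of n0]
  proof eventually_elim
    case (elim n)
    have "q n * g n = r n * (p n * g n)" using supp[OF qpos[OF elim]] by (simp add: r_def)
    moreover have "0 \<le> r n" using nonneg by (simp add: r_def)
    ultimately have "\<bar>q n * g n\<bar> = r n * \<bar>p n * g n\<bar>" by (simp only: abs_mult abs_of_nonneg)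
    then show ?case using rK[OF elim] by (simp add: mult_right_mono)
  qed
  moreover have "(\<lambda>n. K * \<bar>p n * g n\<bar>) \<longlonglongrightarrow> K * \<bar>0\<bar>"
    by (intro tendsto_intros u0)
  ultimately have "\<bar>L\<bar> \<le> K * \<bar>0\<bar>"
    using tendsto_rabs[OF vL] by (intro tendsto_le[OF sequentially_bot]) auto
  then show False using \<open>L \<noteq> 0\<close> by simp
qed

lemma real_nat_floor_Nats: "x \<in> \<nat> \<Longrightarrow> real (nat \<lfloor>x\<rfloor>) = x"
  by (auto elim!: Nats_cases)

section \<open>Densities and generating functions\<close>

text \<open>The improper fundamental theorem for a nonnegative continuous derivative evaluates both
  measures on half-lines \<open>{x<..}\<close>, which determine a finite Borel measure.\<close>

lemma distr_eq_density_cdf_deriv: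
  fixes X :: "'a \<Rightarrow> real" and p :: "real \<Rightarrow> real"
  assumes "prob_space M" and X[measurable]: "X \<in> borel_measurable M" and pos: "AE \<omega> in M. 0 < X \<omega>"
    and deriv: "\<And>w. 0 < w \<Longrightarrow> (cdf (distr M borel X) has_real_derivative p w) (at w)"
    and cont: "\<And>w. 0 < w \<Longrightarrow> isCont p w" and nonneg: "\<And>w. 0 < w \<Longrightarrow> 0 \<le> p w"
  shows "distr M borel X = density lborel (\<lambda>w. ennreal (indicator {0<..} w * p w))"
proof -
  interpret M: prob_space M by fact
  interpret D: real_distribution "distr M borel X"
    by (rule M.real_distribution_distr) simp
  let ?D = "distr M borel X"
  have meas[measurable]: "(\<lambda>w. indicator {0<..} w * p w) \<in> borel_measurable borel"
    using borel_measurable_continuous_on_indicator[of "{0<..}" p] cont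
    by (simp add: continuous_on_eq_continuous_at)
  have "cdf ?D 0 = 0"
  proof -
    have "M.prob {\<omega> \<in> space M. X \<omega> \<le> 0} = M.prob {}"
      using pos by (intro M.finite_measure_eq_AE) (auto elim!: eventually_mono)
    moreover have "X -` {..0} \<inter> space M = {\<omega> \<in> space M. X \<omega> \<le> 0}" by auto
    ultimately show ?thesis by (simp add: cdf_def measure_distr)
  qed
  show ?thesis
  proof (rule measure_eqI_lessThan)
    fix x :: real
    \<comment> \<open>No mass lies at or below 0, and nothing is known about the derivative
      there.\<close>
    define a where "a = max x 0"
    have "a \<ge> 0" by (simp add: a_def)
    have "emeasure ?D {x<..} = emeasure ?D {a<..}"
    proof -
      have "AE \<omega> in ?D. 0 < \<omega>" using pos by (subst AE_distr_iff) auto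
      then show ?thesis by (intro emeasure_eq_AE) (auto simp: a_def elim!: eventually_mono)
    qed
    also have "\<dots> = ennreal (1 - cdf ?D a)"
    proof -
      have "space ?D - {..a} = {a<..}" by auto
      then have "measure ?D {a<..} = 1 - cdf ?D a"
        using D.prob_compl[of "{..a}"] by (simp add: cdf_def)
      then show ?thesis by (simp add: D.emeasure_eq_measure)
    qed
    also have "\<dots> = emeasure (density lborel (\<lambda>w. ennreal (indicator {0<..} w * p w))) {x<..}"
    proof -
      \<comment> \<open>For \<open>a = 0\<close> there is no derivative to rely on; right continuity
        of the distribution function supplies the limit.\<close>
      have lima: "((cdf ?D \<circ> real_of_ereal) \<longlongrightarrow> cdf ?D a) (at_right (ereal a))"
        using D.cdf_is_right_cont[of a]
        by (simp add: ereal_tendsto_simps continuous_within)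
      have limb: "((cdf ?D \<circ> real_of_ereal) \<longlongrightarrow> 1) (at_left \<infinity>)"
        using D.cdf_lim_at_top_prob by (simp add: ereal_tendsto_simps)
      have FTC: "set_integrable lborel (einterval (ereal a) \<infinity>) p"
        "(LBINT x=ereal a..\<infinity>. p x) = 1 - cdf ?D a"
        by (rule interval_integral_FTC_nonneg[OF _ _ _ _ lima limb];
            use \<open>a \<ge> 0\<close> in \<open>auto intro!: deriv cont nonneg\<close>)+
      have E: "einterval (ereal a) \<infinity> = {a<..}" by (auto simp: einterval_def)
      have "emeasure (density lborel (\<lambda>w. ennreal (indicator {0<..} w * p w))) {x<..} =
          (\<integral>\<^sup>+w. ennreal (indicator {0<..} w * p w) * indicator {x<..} w \<partial>lborel)"
        by (rule emeasure_density) measurable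
      also have "\<dots> = (\<integral>\<^sup>+w. ennreal (indicator {a<..} w * p w) \<partial>lborel)"
        by (intro nn_integral_cong) (auto simp: a_def indicator_def)
      also have "\<dots> = ennreal (\<integral>w. indicator {a<..} w * p w \<partial>lborel)"
        using FTC(1) nonneg \<open>a \<ge> 0\<close> unfolding E set_integrable_def
        by (intro nn_integral_eq_integral) (auto simp: indicator_def)
      also have "(\<integral>w. indicator {a<..} w * p w \<partial>lborel) = 1 - cdf ?D a"
        using FTC(2) by (simp add: interval_lebesgue_integral_def E set_lebesgue_integral_def)
      finally show ?thesis by simp
    qed
    finally show "emeasure ?D {x<..} = emeasure (density lborel (\<lambda>w. ennreal (indicator {0<..} w * p w))) {x<..}" .
  qed (auto simp: D.emeasure_finite less_top[symmetric])
qed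

text \<open>The derivative is a pointwise limit of difference quotients with step
  \<open>1 / (n + 1)\<close>. Cutting \<open>f\<close> off outside \<open>S\<close> makes the
  quotients Borel on the whole line, and openness of \<open>S\<close> makes the cut invisible for
  large \<open>n\<close>.\<close>

lemma borel_measurable_deriv_on_open:
  fixes f :: "real \<Rightarrow> real"
  assumes S: "open S" and f: "\<And>x. x \<in> S \<Longrightarrow> f differentiable (at x)"
  shows "(\<lambda>x. indicator S x * deriv f x) \<in> borel_measurable borel"
proof -
  define F where "F x = indicator S x * f x" for x
  have [measurable]: "F \<in> borel_measurable borel"
    unfolding F_def using borel_measurable_continuous_on_indicator[of S f] S f
    by (auto simp: continuous_on_eq_continuous_at differentiable_imp_continuous_within)
  have [measurable]: "S \<in> sets borel" using S by simp
  show ?thesis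
  proof (rule borel_measurable_LIMSEQ_real)
    fix x :: real
    show "(\<lambda>n. indicator S x * ((F (x + 1 / real (Suc n)) - F x) / (1 / real (Suc n)))) \<longlonglongrightarrow> indicator S x * deriv f x"
    proof (cases "x \<in> S")
      case True
      have "(f has_real_derivative deriv f x) (at x)"
        using f[OF True] by (simp add: DERIV_deriv_iff_real_differentiable)
      then have "((\<lambda>h. (f (x + h) - f x) / h) \<longlongrightarrow> deriv f x) (at 0)"
        by (simp add: DERIV_def)
      moreover have lim: "(\<lambda>n. 1 / real (Suc n)) \<longlonglongrightarrow> 0" 
        using LIMSEQ_inverse_real_of_nat by (simp add: inverse_eq_divide)
      ultimately have A: "(\<lambda>n. (f (x + 1 / real (Suc n)) - f x) / (1 / real (Suc n))) \<longlonglongrightarrow> deriv f x"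
        unfolding tendsto_at_iff_sequentially[of _ _ 0 UNIV] o_def
        by (auto dest!: spec[of _ "\<lambda>n. 1 / real (Suc n)"])
      have "(\<lambda>n. x + 1 / real (Suc n)) \<longlonglongrightarrow> x + 0" by (intro tendsto_intros lim)
      then have "\<forall>\<^sub>F n in sequentially. x + 1 / real (Suc n) \<in> S"
        using S True by (intro topological_tendstoD) auto
      then have "\<forall>\<^sub>F n in sequentially. (f (x + 1 / real (Suc n)) - f x) / (1 / real (Suc n)) =
          indicator S x * ((F (x + 1 / real (Suc n)) - F x) / (1 / real (Suc n)))"
        by eventually_elim (use True in \<open>simp add: F_def\<close>)
      from Lim_transform_eventually[OF A this] show ?thesis using True by simp
    qed simp
  qed measurable
qed

text \<open>The law of \<open>K\<close> has density \<open>prob (K = n)\<close> with respect to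
  counting measure, for which integrability is absolute summability.\<close>

lemma (in prob_space) expectation_nat_sums:
  fixes K :: "'a \<Rightarrow> nat" and \<phi> :: "nat \<Rightarrow> real"
  assumes K[measurable]: "K \<in> measurable M (count_space UNIV)"
    and int: "integrable M (\<lambda>\<omega>. \<phi> (K \<omega>))"
  shows "summable (\<lambda>n. \<bar>prob {\<omega> \<in> space M. K \<omega> = n} * \<phi> n\<bar>)"
    and "(\<lambda>n. prob {\<omega> \<in> space M. K \<omega> = n} * \<phi> n) sums expectation (\<lambda>\<omega>. \<phi> (K \<omega>))"
proof -
  let ?\<mu> = "\<lambda>n. prob {\<omega> \<in> space M. K \<omega> = n}"
  have D: "distr M (count_space UNIV) K = density (count_space UNIV) (\<lambda>n. ennreal (?\<mu> n))"
  proof (rule measure_eqI_countable[of _ UNIV])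
    fix n
    have "emeasure (distr M (count_space UNIV) K) {n} = emeasure M {\<omega> \<in> space M. K \<omega> = n}"
      by (subst emeasure_distr) (auto intro!: arg_cong2[where f=emeasure])
    also have "\<dots> = emeasure (density (count_space UNIV) (\<lambda>n. ennreal (?\<mu> n))) {n}"
      by (simp add: emeasure_density emeasure_eq_measure nn_integral_count_space_indicator[symmetric]
           nn_integral_count_space_finite)
    finally show "emeasure (distr M (count_space UNIV) K) {n} =
      emeasure (density (count_space UNIV) (\<lambda>n. ennreal (?\<mu> n))) {n}" .
  qed auto
  have "integrable (distr M (count_space UNIV) K) \<phi>"
    using int by (simp add: integrable_distr_eq)
  then have i: "integrable (count_space UNIV) (\<lambda>n. ?\<mu> n * \<phi> n)"
    unfolding D by (subst (asm) integrable_density) auto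
  then show "summable (\<lambda>n. \<bar>?\<mu> n * \<phi> n\<bar>)"
    by (simp add: integrable_count_space_nat_iff)
  have "expectation (\<lambda>\<omega>. \<phi> (K \<omega>)) = integral\<^sup>L (distr M (count_space UNIV) K) \<phi>"
    by (simp add: integral_distr)
  also have "\<dots> = (\<integral>n. ?\<mu> n * \<phi> n \<partial>count_space UNIV)"
    unfolding D by (subst integral_density) auto
  finally show "(\<lambda>n. ?\<mu> n * \<phi> n) sums expectation (\<lambda>\<omega>. \<phi> (K \<omega>))"
    using sums_integral_count_space_nat[OF i] by simp
qed

section \<open>Differentiation under the expectation of a random power\<close>

lemma power_diff_le:
  fixes x y :: real
  assumes "x \<in> {0..1}" "y \<in> {0..1}"
  shows "\<bar>x ^ n - y ^ n\<bar> \<le> real n * \<bar>x - y\<bar>"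
  using norm_power_diff[of x y n] assms by auto

text \<open>Dominated convergence of difference quotients, with dominating function
  \<open>|c * m|\<close>. The weight \<open>c\<close> permits iteration: \<open>c = 1\<close>,
  \<open>m = N\<close> gives the first derivative of the generating function, \<open>c = N\<close>,
  \<open>m = N - 1\<close> the second. Working within \<open>{0..1}\<close> includes the one-sided
  derivatives at the ends.\<close>

lemma integral_power_has_derivative:
  fixes c :: "'a \<Rightarrow> real" and m :: "'a \<Rightarrow> nat"
  assumes c: "integrable M c" and [measurable]: "m \<in> measurable M (count_space UNIV)"
    and cm: "integrable M (\<lambda>\<omega>. c \<omega> * real (m \<omega>))" and x: "x \<in> {0..1}"
  shows "((\<lambda>x. \<integral>\<omega>. c \<omega> * x ^ m \<omega> \<partial>M) has_real_derivative
            (\<integral>\<omega>. c \<omega> * real (m \<omega>) * x ^ (m \<omega> - 1) \<partial>M)) (at x within {0..1})"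
  unfolding has_field_derivative_iff tendsto_at_iff_sequentially
proof (intro allI impI)
  have [measurable]: "c \<in> borel_measurable M" using c by auto
  fix X :: "nat \<Rightarrow> real"
  assume X: "\<forall>i. X i \<in> {0..1} - {x}" "X \<longlonglongrightarrow> x"
  have int: "integrable M (\<lambda>\<omega>. c \<omega> * y ^ m \<omega>)" if "y \<in> {0..1}" for y :: real
    by (rule Bochner_Integration.integrable_bound[OF c])
       (use that in \<open>auto simp: abs_mult power_le_one mult_left_le\<close>)
  have eq: "((\<integral>\<omega>. c \<omega> * X i ^ m \<omega> \<partial>M) - (\<integral>\<omega>. c \<omega> * x ^ m \<omega> \<partial>M)) / (X i - x) =
      (\<integral>\<omega>. c \<omega> * ((X i ^ m \<omega> - x ^ m \<omega>) / (X i - x)) \<partial>M)" for i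
  proof -
    have "(\<integral>\<omega>. c \<omega> * X i ^ m \<omega> \<partial>M) - (\<integral>\<omega>. c \<omega> * x ^ m \<omega> \<partial>M) = (\<integral>\<omega>. c \<omega> * X i ^ m \<omega> - c \<omega> * x ^ m \<omega> \<partial>M)"
      using int[of "X i"] int[OF x] X(1) by (intro Bochner_Integration.integral_diff[symmetric]) auto
    also have "\<dots> / (X i - x) = (\<integral>\<omega>. (c \<omega> * X i ^ m \<omega> - c \<omega> * x ^ m \<omega>) / (X i - x) \<partial>M)"
      by (rule integral_divide_zero[symmetric])
    finally show ?thesis by (simp add: right_diff_distrib)
  qed
  have "(\<lambda>i. \<integral>\<omega>. c \<omega> * ((X i ^ m \<omega> - x ^ m \<omega>) / (X i - x)) \<partial>M) \<longlonglongrightarrow>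
      (\<integral>\<omega>. c \<omega> * (real (m \<omega>) * x ^ (m \<omega> - 1)) \<partial>M)"
  proof (rule integral_dominated_convergence[where w="\<lambda>\<omega>. \<bar>c \<omega> * real (m \<omega>)\<bar>"])
    show "AE \<omega> in M. (\<lambda>i. c \<omega> * ((X i ^ m \<omega> - x ^ m \<omega>) / (X i - x))) \<longlonglongrightarrow> c \<omega> * (real (m \<omega>) * x ^ (m \<omega> - 1))"
    proof (rule AE_I2)
      fix \<omega>
      have "((\<lambda>y. (y ^ m \<omega> - x ^ m \<omega>) / (y - x)) \<longlongrightarrow> real (m \<omega>) * x ^ (m \<omega> - 1)) (at x within {0..1})"
        using DERIV_pow[of "m \<omega>" x "{0..1}"] by (simp add: has_field_derivative_iff)
      then have "(\<lambda>i. (X i ^ m \<omega> - x ^ m \<omega>) / (X i - x)) \<longlonglongrightarrow> real (m \<omega>) * x ^ (m \<omega> - 1)"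
        using X unfolding tendsto_at_iff_sequentially o_def by blast
      then show "(\<lambda>i. c \<omega> * ((X i ^ m \<omega> - x ^ m \<omega>) / (X i - x))) \<longlonglongrightarrow> c \<omega> * (real (m \<omega>) * x ^ (m \<omega> - 1))"
        by (intro tendsto_intros)
    qed
    show "AE \<omega> in M. norm (c \<omega> * ((X i ^ m \<omega> - x ^ m \<omega>) / (X i - x))) \<le> \<bar>c \<omega> * real (m \<omega>)\<bar>" for i
    proof (rule AE_I2)
      fix \<omega>
      have "\<bar>(X i ^ m \<omega> - x ^ m \<omega>) / (X i - x)\<bar> \<le> real (m \<omega>)"
        using power_diff_le[of "X i" x "m \<omega>"] X(1) x by (auto simp: abs_divide divide_le_eq)
      from mult_left_mono[OF this, of "\<bar>c \<omega>\<bar>"]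
      show "norm (c \<omega> * ((X i ^ m \<omega> - x ^ m \<omega>) / (X i - x))) \<le> \<bar>c \<omega> * real (m \<omega>)\<bar>"
        by (simp add: abs_mult)
    qed
  qed (use cm in auto)
  then show "((\<lambda>y. ((\<integral>\<omega>. c \<omega> * y ^ m \<omega> \<partial>M) - (\<integral>\<omega>. c \<omega> * x ^ m \<omega> \<partial>M)) / (y - x)) \<circ> X) \<longlonglongrightarrow>
      (\<integral>\<omega>. c \<omega> * real (m \<omega>) * x ^ (m \<omega> - 1) \<partial>M)"
    unfolding o_def eq by (simp add: mult.assoc)
qed

section \<open>The law of a CCR random variable\<close>

context ccr
begin

lemma N_integrable: "integrable P (\<lambda>\<omega>. real (N \<omega>))"
  using N_measurable
  by (intro Bochner_Integration.integrable_bound[OF N_second_moment])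
     (auto simp: power2_eq_square simp flip: of_nat_mult intro!: AE_I2)

lemma pgf_has_derivative:
  assumes "x \<in> {0..1}"
  shows "(pgf P N has_real_derivative pgf' P N x) (at x within {0..1})"
    and "pgf' P N x = (\<integral>\<omega>. real (N \<omega>) * x ^ (N \<omega> - 1) \<partial>P)"
proof -
  have "(pgf P N has_real_derivative (\<integral>\<omega>. real (N \<omega>) * x ^ (N \<omega> - 1) \<partial>P)) (at x within {0..1})"
    using integral_power_has_derivative[of P "\<lambda>_. 1" N x] N_integrable N_measurable assms
    by (simp add: pgf_def[abs_def])
  moreover from this show "pgf' P N x = (\<integral>\<omega>. real (N \<omega>) * x ^ (N \<omega> - 1) \<partial>P)"
    unfolding pgf'_def has_real_derivative_iff_has_vector_derivative
    using assms by (intro vector_derivative_within_closed_interval) auto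
  ultimately show "(pgf P N has_real_derivative pgf' P N x) (at x within {0..1})" by simp
qed

lemma pgf'_has_derivative:
  assumes "x \<in> {0..1}"
  shows "(pgf' P N has_real_derivative pgf'' P N x) (at x within {0..1})"
proof -
  have [measurable]: "N \<in> measurable P (count_space UNIV)" by (rule N_measurable)
  \<comment> \<open>This is where the second moment enters. Truncated subtraction at
    \<open>N = 0\<close> is harmless because of the factor \<open>N\<close>.\<close>
  have i: "integrable P (\<lambda>\<omega>. real (N \<omega>) * real (N \<omega> - 1))"
  proof (rule Bochner_Integration.integrable_bound[OF N_second_moment])
    show "AE \<omega> in P. norm (real (N \<omega>) * real (N \<omega> - 1)) \<le> norm ((real (N \<omega>))\<^sup>2)"
      by (rule AE_I2) (simp add: power2_eq_square mult_left_mono)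
  qed measurable
  let ?D = "\<integral>\<omega>. real (N \<omega>) * real (N \<omega> - 1) * x ^ (N \<omega> - 1 - 1) \<partial>P"
  have "((\<lambda>x. \<integral>\<omega>. real (N \<omega>) * x ^ (N \<omega> - 1) \<partial>P) has_real_derivative ?D) (at x within {0..1})"
    using N_integrable i assms by (intro integral_power_has_derivative) auto
  then have D: "(pgf' P N has_real_derivative ?D) (at x within {0..1})"
    by (rule has_field_derivative_transform_within[OF _ zero_less_one assms]) (simp add: pgf_has_derivative(2))
  then have "pgf'' P N x = ?D"
    unfolding pgf''_def has_real_derivative_iff_has_vector_derivative
    using assms by (intro vector_derivative_within_closed_interval) auto
  then show ?thesis using D by simp
qed

lemma pgf'_nonneg: "x \<in> {0..1} \<Longrightarrow> 0 \<le> pgf' P N x"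
  by (subst pgf_has_derivative(2)) auto

text \<open>Since \<open>N\<close> is almost surely at least 1, the integrand
  \<open>N * x ^ (N - 1)\<close> is positive for \<open>x > 0\<close>. At 0 the value is the
  probability of \<open>N = 1\<close>, which may be 0.\<close>

lemma pgf'_pos:
  assumes "x \<in> {0<..1}" shows "0 < pgf' P N x"
proof -
  have [measurable]: "N \<in> measurable P (count_space UNIV)" by (rule N_measurable)
  have i: "integrable P (\<lambda>\<omega>. real (N \<omega>) * x ^ (N \<omega> - 1))"
    by (intro Bochner_Integration.integrable_bound[OF N_integrable])
       (use assms in \<open>simp_all add: power_le_one mult_left_le\<close>)
  have "(\<integral>\<omega>. real (N \<omega>) * x ^ (N \<omega> - 1) \<partial>P) \<noteq> 0"
  proof
    assume "(\<integral>\<omega>. real (N \<omega>) * x ^ (N \<omega> - 1) \<partial>P) = 0"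
    then have "AE \<omega> in P. real (N \<omega>) * x ^ (N \<omega> - 1) = 0"
      using i assms by (subst (asm) integral_nonneg_eq_0_iff_AE) auto
    with N_ge_1 have "AE \<omega> in P. False"
      by eventually_elim (use assms in auto)
    then show False by simp
  qed
  then have "pgf' P N x \<noteq> 0"
    using assms by (subst pgf_has_derivative(2)) auto
  then show ?thesis
    using pgf'_nonneg[of x] assms by auto
qed

section \<open>The extreme of a random number of variables\<close>

lemma all_Y_events:
  assumes "B \<in> sets borel"
  shows "{\<omega> \<in> space P. \<forall>i\<in>{1..n}. Y i \<omega> \<in> B} \<in> events"
  using assms Y_measurable
  by (intro sets.sets_Collect_finite_All) (auto intro: measurable_sets_Collect simp: Measurable.pred_def)

lemma prob_all_Y:
  assumes B: "B \<in> sets borel"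
  shows "prob {\<omega> \<in> space P. \<forall>i\<in>{1..n}. Y i \<omega> \<in> B} = prob {\<omega> \<in> space P. Y 1 \<omega> \<in> B} ^ n"
\<comment> \<open>The product rule for independent variables is applied to a nonempty index set; for
  \<open>n = 0\<close> both sides are 1.\<close>
proof (cases "n = 0")
  case False
  have q: "prob (Y i -` B \<inter> space P) = prob {\<omega> \<in> space P. Y 1 \<omega> \<in> B}" if "i \<ge> 1" for i
  proof -
    have "prob (Y i -` B \<inter> space P) = measure (distr P borel (Y i)) B"
      using Y_measurable[OF that] B by (simp add: measure_distr)
    also have "\<dots> = measure (distr P borel (Y 1)) B" by (simp only: Y_ident[OF that])
    also have "\<dots> = prob (Y 1 -` B \<inter> space P)"
      using Y_measurable[of 1] B by (simp add: measure_distr)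
    also have "Y 1 -` B \<inter> space P = {\<omega> \<in> space P. Y 1 \<omega> \<in> B}" by auto
    finally show ?thesis .
  qed
  have "{\<omega> \<in> space P. \<forall>i\<in>{1..n}. Y i \<omega> \<in> B} = (\<Inter>i\<in>{1..n}. Y i -` B \<inter> space P)"
    using False by auto
  also have "prob \<dots> = (\<Prod>i\<in>{1..n}. prob (Y i -` B \<inter> space P))"
    using False B by (intro indep_varsD[OF Y_indep]) auto
  also have "\<dots> = (\<Prod>i\<in>{1..n}. prob {\<omega> \<in> space P. Y 1 \<omega> \<in> B})"
    by (intro prod.cong refl q) auto
  finally show ?thesis by simp
qed (simp add: prob_space)

text \<open>Splitting according to the value of \<open>N\<close> and using independence gives the
  series of \<open>prob (N = n) * q ^ n\<close>, which is the generating function at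
  \<open>q\<close>.\<close>

lemma prob_all_Y_upto_N:
  assumes B: "B \<in> sets borel"
  shows "{\<omega> \<in> space P. \<forall>i\<in>{1..N \<omega>}. Y i \<omega> \<in> B} \<in> events" (is "?A \<in> _")
    and "prob {\<omega> \<in> space P. \<forall>i\<in>{1..N \<omega>}. Y i \<omega> \<in> B} = pgf P N (prob {\<omega> \<in> space P. Y 1 \<omega> \<in> B})"
proof -
  have [measurable]: "N \<in> measurable P (count_space UNIV)" by (rule N_measurable)
  define q where "q = prob {\<omega> \<in> space P. Y 1 \<omega> \<in> B}"
  let ?E = "\<lambda>n. {\<omega> \<in> space P. N \<omega> = n}" and ?B = "\<lambda>n. {\<omega> \<in> space P. \<forall>i\<in>{1..n}. Y i \<omega> \<in> B}"
  let ?Y = "\<lambda>\<omega>. \<lambda>i\<in>{1..}. Y i \<omega>"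
  have U: "?A = (\<Union>n. ?E n \<inter> ?B n)" by auto
  have ev: "?E n \<inter> ?B n \<in> events" for n using all_Y_events[OF B] by auto
  show "?A \<in> events" unfolding U using ev by blast
  have p: "prob (?E n \<inter> ?B n) = prob (?E n) * q ^ n" for n
  proof -
    \<comment> \<open>Independence of \<open>N\<close> is stated for the sigma-algebra of the whole
      sequence, so the event must appear as the preimage of a measurable set of sequences.\<close>
    let ?R = "{x \<in> space (Pi\<^sub>M {1..} (\<lambda>_::nat. borel :: real measure)). \<forall>i\<in>{1..n}. x i \<in> B}"
    have "?R \<in> sets (Pi\<^sub>M {1..} (\<lambda>_. borel))"
      using B by (intro sets.sets_Collect_finite_All measurable_sets_Collect[OF measurable_component_singleton]) auto
    from in_vimage_algebra[OF this, of ?Y "space P"]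
    have "?Y -` ?R \<inter> space P \<in> sets (vimage_algebra (space P) ?Y (Pi\<^sub>M {1..} (\<lambda>_. borel)))" .
    moreover have "?Y -` ?R \<inter> space P = ?B n" by (auto simp: space_PiM)
    moreover have "N -` {n} \<inter> space P \<in> sets (vimage_algebra (space P) N (count_space UNIV))"
      by (rule in_vimage_algebra) simp
    moreover have "N -` {n} \<inter> space P = ?E n" by auto
    ultimately have "prob (?E n \<inter> ?B n) = prob (?E n) * prob (?B n)"
      by (intro indep_setD[OF N_Y_indep]) simp_all
    then show ?thesis using prob_all_Y[OF B] by (simp add: q_def)
  qed
  have "(\<lambda>n. prob (?E n \<inter> ?B n)) sums prob (\<Union>n. ?E n \<inter> ?B n)"
    by (rule finite_measure_UNION) (use ev in \<open>auto simp: disjoint_family_on_def\<close>)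
  then have "(\<lambda>n. prob (?E n) * q ^ n) sums prob ?A"
    using p U by simp
  moreover have "q \<in> {0..1}" by (simp add: q_def)
  then have "integrable P (\<lambda>\<omega>. q ^ N \<omega>)"
    by (intro integrable_const_bound[of _ 1]) (auto simp: power_le_one)
  then have "(\<lambda>n. prob (?E n) * q ^ n) sums pgf P N q"
    unfolding pgf_def by (intro expectation_nat_sums(2)) auto
  ultimately show "prob ?A = pgf P N (prob {\<omega> \<in> space P. Y 1 \<omega> \<in> B})"
    unfolding q_def[symmetric] by (rule sums_unique2)
qed

lemma ccr_W_measurable [measurable]: "ccr_W \<alpha> N Y \<in> borel_measurable P"
proof -
  have "(\<lambda>\<omega>. if \<alpha> = -1 then Min ((\<lambda>i. Y i \<omega>) ` {1..n}) else Max ((\<lambda>i. Y i \<omega>) ` {1..n})) \<in> borel_measurable P" for n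
    using Y_measurable by (cases "\<alpha> = -1") (auto intro!: borel_measurable_Min borel_measurable_Max)
  from measurable_compose_countable[OF this N_measurable] show ?thesis
    by (simp add: ccr_W_def[abs_def])
qed

text \<open>As \<open>N\<close> is almost surely at least 1, \<open>W\<close> equals one of
  countably many \<open>Y i\<close> and inherits what holds almost surely for all of them.\<close>

lemma AE_ccr_W:
  assumes "\<And>i. i \<ge> 1 \<Longrightarrow> AE \<omega> in P. R (Y i \<omega>)"
  shows "AE \<omega> in P. R (ccr_W \<alpha> N Y \<omega>)"
proof -
  have "AE \<omega> in P. \<forall>i. i \<ge> 1 \<longrightarrow> R (Y i \<omega>)"
    unfolding AE_all_countable using assms by auto
  with N_ge_1 show ?thesis
  proof eventually_elim
    case (elim \<omega>)
    then have "ccr_W \<alpha> N Y \<omega> \<in> (\<lambda>i. Y i \<omega>) ` {1..N \<omega>}"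
      unfolding ccr_W_def using Min_in[of "(\<lambda>i. Y i \<omega>) ` {1..N \<omega>}"] Max_in[of "(\<lambda>i. Y i \<omega>) ` {1..N \<omega>}"] by auto
    then show ?case using elim by auto
  qed
qed

lemma ccr_W_pos: "AE \<omega> in P. 0 < ccr_W \<alpha> N Y \<omega>"
  by (rule AE_ccr_W) (rule Y_pos)

lemma cdf_Y: "cdf (distr P borel (Y 1)) x = prob {\<omega> \<in> space P. Y 1 \<omega> \<in> {..x}}"
proof -
  have "Y 1 -` {..x} \<inter> space P = {\<omega> \<in> space P. Y 1 \<omega> \<in> {..x}}" by auto
  then show ?thesis using Y_measurable[of 1] by (simp add: cdf_def measure_distr)
qed

lemma ccr_U_range: "ccr_U \<alpha> P Y x \<in> {0..1}"
  using cdf_Y[of x] by (simp add: ccr_U_def)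

text \<open>A minimum exceeds \<open>x\<close> iff all terms do, a maximum is at most
  \<open>x\<close> iff all terms are. \<open>ccr_U\<close> is the probability of this for one term,
  so the composition is the survival function of a minimum or the distribution function of a
  maximum.\<close>

lemma pgf_ccr_U:
  "pgf P N (ccr_U \<alpha> P Y x) =
     (if \<alpha> = -1 then prob {\<omega> \<in> space P. ccr_W \<alpha> N Y \<omega> \<in> {x<..}}
      else prob {\<omega> \<in> space P. ccr_W \<alpha> N Y \<omega> \<in> {..x}})"
proof -
  have [measurable]: "ccr_W \<alpha> N Y \<in> borel_measurable P" by (rule ccr_W_measurable)
  have [measurable]: "Y (Suc 0) \<in> borel_measurable P" using Y_measurable by simp
  show ?thesis
  proof (cases "\<alpha> = -1")
    case True
    have "prob {\<omega> \<in> space P. Y 1 \<omega> \<in> {x<..}} = 1 - prob {\<omega> \<in> space P. Y 1 \<omega> \<in> {..x}}"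
      by (subst prob_compl[symmetric]) (auto intro!: arg_cong[where f=prob])
    then have "pgf P N (ccr_U \<alpha> P Y x) = prob {\<omega> \<in> space P. \<forall>i\<in>{1..N \<omega>}. Y i \<omega> \<in> {x<..}}"
      using prob_all_Y_upto_N(2)[of "{x<..}"] True cdf_Y[of x] by (simp add: ccr_U_def)
    also have "\<dots> = prob {\<omega> \<in> space P. ccr_W \<alpha> N Y \<omega> \<in> {x<..}}"
    proof (rule finite_measure_eq_AE)
      show "AE \<omega> in P. (\<omega> \<in> {\<omega> \<in> space P. \<forall>i\<in>{1..N \<omega>}. Y i \<omega> \<in> {x<..}}) =
          (\<omega> \<in> {\<omega> \<in> space P. ccr_W \<alpha> N Y \<omega> \<in> {x<..}})"
        using N_ge_1 by eventually_elim (auto simp: ccr_W_def True)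
    qed (use prob_all_Y_upto_N(1)[of "{x<..}"] in \<open>auto intro: measurable_sets_Collect\<close>)
    finally show ?thesis using True by simp
  next
    case False
    then have "pgf P N (ccr_U \<alpha> P Y x) = prob {\<omega> \<in> space P. \<forall>i\<in>{1..N \<omega>}. Y i \<omega> \<in> {..x}}"
      using prob_all_Y_upto_N(2)[of "{..x}"] cdf_Y[of x] by (simp add: ccr_U_def)
    also have "\<dots> = prob {\<omega> \<in> space P. ccr_W \<alpha> N Y \<omega> \<in> {..x}}"
    proof (rule finite_measure_eq_AE)
      show "AE \<omega> in P. (\<omega> \<in> {\<omega> \<in> space P. \<forall>i\<in>{1..N \<omega>}. Y i \<omega> \<in> {..x}}) =
          (\<omega> \<in> {\<omega> \<in> space P. ccr_W \<alpha> N Y \<omega> \<in> {..x}})"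
        using N_ge_1 by eventually_elim (auto simp: ccr_W_def False)
    qed (use prob_all_Y_upto_N(1)[of "{..x}"] in \<open>auto intro: measurable_sets_Collect\<close>)
    finally show ?thesis using False by simp
  qed
qed

section \<open>The law of \<open>W\<close> for integer-valued variables\<close>

definition mass :: "real \<Rightarrow> nat \<Rightarrow> real" where
  "mass \<alpha> n = prob {\<omega> \<in> space P. ccr_W \<alpha> N Y \<omega> = real n}"

context
  assumes Y_nat: "\<And>i. i \<ge> 1 \<Longrightarrow> AE \<omega> in P. Y i \<omega> \<in> \<nat>"
begin

lemma ccr_W_nat: "AE \<omega> in P. ccr_W \<alpha> N Y \<omega> \<in> \<nat>"
  by (rule AE_ccr_W) (rule Y_nat)

text \<open>The sign comes from the survival function, which decreases where the distribution
  function increases.\<close>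

lemma bdiff_pgf_ccr_U:
  "bdiff (pgf P N \<circ> ccr_U \<alpha> P Y) (real n) = (if \<alpha> = -1 then -1 else 1) * mass \<alpha> n"
proof -
  have [measurable]: "ccr_W \<alpha> N Y \<in> borel_measurable P" by (rule ccr_W_measurable)
  let ?F = "\<lambda>x. prob {\<omega> \<in> space P. ccr_W \<alpha> N Y \<omega> \<in> {..x}}"
  have compl: "prob {\<omega> \<in> space P. ccr_W \<alpha> N Y \<omega> \<in> {x<..}} = 1 - ?F x" for x
    by (subst prob_compl[symmetric]) (auto intro!: arg_cong[where f=prob])
  have "?F (real n) - ?F (real n - 1) =
      prob ({\<omega> \<in> space P. ccr_W \<alpha> N Y \<omega> \<in> {..real n}} - {\<omega> \<in> space P. ccr_W \<alpha> N Y \<omega> \<in> {..real n - 1}})"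
    by (rule finite_measure_Diff[symmetric]) auto
  also have "\<dots> = mass \<alpha> n"
    unfolding mass_def
  proof (rule finite_measure_eq_AE)
    show "AE \<omega> in P. (\<omega> \<in> {\<omega> \<in> space P. ccr_W \<alpha> N Y \<omega> \<in> {..real n}} - {\<omega> \<in> space P. ccr_W \<alpha> N Y \<omega> \<in> {..real n - 1}})
        = (\<omega> \<in> {\<omega> \<in> space P. ccr_W \<alpha> N Y \<omega> = real n})"
      using ccr_W_nat[of \<alpha>]
    proof eventually_elim
      case (elim \<omega>)
      then obtain m where "ccr_W \<alpha> N Y \<omega> = real m" by (auto elim: Nats_cases)
      then show ?case by auto
    qed
  qed measurable
  finally have "?F (real n) - ?F (real n - 1) = mass \<alpha> n" .
  then show ?thesis
    using compl[of "real n"] compl[of "real n - 1"]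
    by (cases "\<alpha> = -1") (auto simp: bdiff_def pgf_ccr_U)
qed

lemma mass_0: "mass \<alpha> 0 = 0"
proof -
  have [measurable]: "ccr_W \<alpha> N Y \<in> borel_measurable P" by (rule ccr_W_measurable)
  have "prob {\<omega> \<in> space P. ccr_W \<alpha> N Y \<omega> = real 0} = prob {}"
    using ccr_W_pos[of \<alpha>]
    by (intro finite_measure_eq_AE) (auto elim!: eventually_mono)
  then show ?thesis by (simp add: mass_def)
qed

text \<open>The naturals are closed with spacing 1: a ball of radius 1 about one of them meets no
  other, and any other real has a ball missing them all.\<close>

lemma rv_support_nat: "rv_support P (ccr_W \<alpha> N Y) = {x. \<exists>n. x = real n \<and> 0 < mass \<alpha> n}"
proof (intro equalityI subsetI CollectI)
  have [measurable]: "ccr_W \<alpha> N Y \<in> borel_measurable P" by (rule ccr_W_measurable)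
  note nat = ccr_W_nat[of \<alpha>]
  fix x assume "x \<in> rv_support P (ccr_W \<alpha> N Y)"
  then have pos: "0 < prob {\<omega> \<in> space P. dist (ccr_W \<alpha> N Y \<omega>) x < e}" if "0 < e" for e
    using that by (simp add: rv_support_def)
  show "\<exists>n. x = real n \<and> 0 < mass \<alpha> n"
  proof (cases "x \<in> \<nat>")
    case True
    then obtain n where n: "x = real n" by (auto elim: Nats_cases)
    have "prob {\<omega> \<in> space P. dist (ccr_W \<alpha> N Y \<omega>) x < 1} = mass \<alpha> n"
      unfolding mass_def
    proof (rule finite_measure_eq_AE)
      show "AE \<omega> in P. (\<omega> \<in> {\<omega> \<in> space P. dist (ccr_W \<alpha> N Y \<omega>) x < 1}) =
          (\<omega> \<in> {\<omega> \<in> space P. ccr_W \<alpha> N Y \<omega> = real n})"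
        using nat
      proof eventually_elim
        case (elim \<omega>)
        then obtain m where "ccr_W \<alpha> N Y \<omega> = real m" by (auto elim: Nats_cases)
        then show ?case by (auto simp: n dist_real_def)
      qed
    qed measurable
    then show ?thesis using pos[of 1] n by auto
  next
    case False
    have "closed (\<nat> :: real set)" unfolding Nats_def by (rule closed_of_nat_image)
    then obtain e where e: "0 < e" "ball x e \<subseteq> - \<nat>"
      using False open_contains_ball[of "- \<nat> :: real set"] by (auto simp: closed_def)
    have "prob {\<omega> \<in> space P. dist (ccr_W \<alpha> N Y \<omega>) x < e} = prob {}"
    proof (rule finite_measure_eq_AE)
      show "AE \<omega> in P. (\<omega> \<in> {\<omega> \<in> space P. dist (ccr_W \<alpha> N Y \<omega>) x < e}) = (\<omega> \<in> {})"
        using nat by eventually_elim (use e in \<open>auto simp: subset_eq dist_commute\<close>)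
    qed measurable
    then show ?thesis using pos[OF e(1)] by simp
  qed
next
  have [measurable]: "ccr_W \<alpha> N Y \<in> borel_measurable P" by (rule ccr_W_measurable)
  fix x assume "x \<in> {x. \<exists>n. x = real n \<and> 0 < mass \<alpha> n}"
  then obtain n where n: "x = real n" "0 < mass \<alpha> n" by auto
  have "0 < prob {\<omega> \<in> space P. dist (ccr_W \<alpha> N Y \<omega>) x < e}" if "0 < e" for e
  proof -
    have "mass \<alpha> n \<le> prob {\<omega> \<in> space P. dist (ccr_W \<alpha> N Y \<omega>) x < e}"
      unfolding mass_def by (rule finite_measure_mono) (use n that in auto)
    then show ?thesis using n(2) by simp
  qed
  then show "x \<in> rv_support P (ccr_W \<alpha> N Y)" by (simp add: rv_support_def)
qed

text \<open>\<open>W\<close> is replaced by the almost surely equal integer variable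
  \<open>K\<close>. Its values lie in a discrete space, so an arbitrary \<open>h\<close> of it is
  measurable.\<close>

lemma expectation_ccr_W_sums:
  assumes "integrable P (\<lambda>\<omega>. h (ccr_W \<alpha> N Y \<omega>))"
  shows "summable (\<lambda>n. \<bar>mass \<alpha> n * h (real n)\<bar>)"
    and "(\<lambda>n. mass \<alpha> n * h (real n)) sums expectation (\<lambda>\<omega>. h (ccr_W \<alpha> N Y \<omega>))"
proof -
  have [measurable]: "ccr_W \<alpha> N Y \<in> borel_measurable P" by (rule ccr_W_measurable)
  define K where "K \<omega> = nat \<lfloor>ccr_W \<alpha> N Y \<omega>\<rfloor>" for \<omega>
  have K[measurable]: "K \<in> measurable P (count_space UNIV)" unfolding K_def by measurable
  have W: "AE \<omega> in P. ccr_W \<alpha> N Y \<omega> = real (K \<omega>)"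
    using ccr_W_nat[of \<alpha>]
    by eventually_elim (simp add: K_def real_nat_floor_Nats)
  have m: "prob {\<omega> \<in> space P. K \<omega> = n} = mass \<alpha> n" for n
    unfolding mass_def by (rule finite_measure_eq_AE) (use W in \<open>auto elim!: eventually_mono\<close>)
  have m1: "(\<lambda>\<omega>. h (real (K \<omega>))) \<in> borel_measurable P" by measurable
  have "integrable P (\<lambda>\<omega>. h (real (K \<omega>)))"
    using assms W m1 by (subst integrable_cong_AE[where g="\<lambda>\<omega>. h (ccr_W \<alpha> N Y \<omega>)"]) (auto elim!: eventually_mono)
  note S = expectation_nat_sums[OF K this]
  have h: "AE \<omega> in P. h (ccr_W \<alpha> N Y \<omega>) = h (real (K \<omega>))"
    using W by eventually_elim simp
  have "expectation (\<lambda>\<omega>. h (ccr_W \<alpha> N Y \<omega>)) = expectation (\<lambda>\<omega>. h (real (K \<omega>)))"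
    using assms m1 h by (intro integral_cong_AE) auto
  with S show "summable (\<lambda>n. \<bar>mass \<alpha> n * h (real n)\<bar>)"
    and "(\<lambda>n. mass \<alpha> n * h (real n)) sums expectation (\<lambda>\<omega>. h (ccr_W \<alpha> N Y \<omega>))"
    by (simp_all add: m)
qed

end

section \<open>The law of \<open>W\<close> for variables with a differentiable density\<close>

context
  fixes f :: "real \<Rightarrow> real" and \<alpha> :: real
  assumes f: "has_differentiable_pdf P Y f" and \<alpha>: "\<alpha> \<in> {-1, 1}"
begin

lemma f_nonneg: "0 \<le> f w"
  using f by (simp add: has_differentiable_pdf_def)

lemma f_deriv: "0 < w \<Longrightarrow> (f has_real_derivative deriv f w) (at w)"
  using f by (simp add: has_differentiable_pdf_def DERIV_deriv_iff_real_differentiable)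

lemma Y_density: "distr P lborel (Y 1) = density lborel f" "f \<in> borel_measurable borel"
proof -
  have "distributed P lborel (Y 1) f" using f by (simp add: has_differentiable_pdf_def)
  then show "distr P lborel (Y 1) = density lborel f" "f \<in> borel_measurable borel"
    using distributed_real_measurable[of lborel f P "Y 1"] f_nonneg
    by (auto simp: distributed_distr_eq_density)
qed

text \<open>On the positive half-line \<open>f\<close> is differentiable, hence continuous, so near
  \<open>w\<close> the distribution function is a constant plus the integral of a continuous
  function.\<close>

lemma cdf_Y_deriv:
  assumes "0 < w" shows "(cdf (distr P borel (Y 1)) has_real_derivative f w) (at w)"
proof -
  let ?D = "density lborel f"
  have [measurable]: "f \<in> borel_measurable borel" by (rule Y_density)
  have D: "distr P borel (Y 1) = ?D"
    using Y_density(1) by (simp cong: distr_cong)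
  interpret D: real_distribution "distr P borel (Y 1)"
    using Y_measurable[of 1] by (intro real_distribution_distr) simp
  define a b where "a = w / 2" and "b = 2 * w"
  have ab: "0 < a" "a < w" "w < b" using assms by (auto simp: a_def b_def)
  have cont: "continuous_on {a..b} f"
    using ab by (intro continuous_at_imp_continuous_on) (auto intro!: DERIV_isCont[OF f_deriv])
  have eq: "cdf (distr P borel (Y 1)) x = cdf (distr P borel (Y 1)) a + integral {a..x} f" if "x \<in> {a..b}" for x
  proof -
    have "emeasure ?D {a<..x} = (\<integral>\<^sup>+t. ennreal (f t * indicator {a<..x} t) \<partial>lborel)"
      using f_nonneg by (subst emeasure_density) (auto intro!: nn_integral_cong simp: indicator_def)
    also have "\<dots> = (\<integral>\<^sup>+t. ennreal (f t * indicator {a..x} t) \<partial>lborel)"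
      using AE_lborel_singleton[of a]
      by (intro nn_integral_cong_AE) (auto elim!: eventually_mono simp: indicator_def)
    also have "\<dots> = ennreal (integral {a..x} f)"
    proof -
      have "set_integrable lborel {a..x} f"
        using continuous_on_subset[OF cont, of "{a..x}"] that by (intro borel_integrable_atLeastAtMost') auto
      from set_borel_integral_eq_integral(2)[OF this] this show ?thesis
        using f_nonneg unfolding set_integrable_def set_lebesgue_integral_def
        by (subst nn_integral_eq_integral) (auto simp: mult.commute)
    qed
    finally have "measure ?D {a<..x} = integral {a..x} f"
      using continuous_on_subset[OF cont, of "{a..x}"] that f_nonneg
      by (simp add: measure_def integral_nonneg integrable_continuous_interval)
    then show ?thesis
      using D.cdf_diff_eq[of a x] that unfolding D by (cases "a = x") auto
  qed
  have "((\<lambda>x. integral {a..x} f) has_real_derivative f w) (at w within {a..b})"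
    using cont ab by (intro integral_has_real_derivative) auto
  then have "((\<lambda>x. integral {a..x} f) has_real_derivative f w) (at w)"
    using ab by (simp add: at_within_Icc_at)
  then have "((\<lambda>x. cdf (distr P borel (Y 1)) a + integral {a..x} f) has_real_derivative f w) (at w)"
    by (auto intro!: derivative_eq_intros)
  then show ?thesis
  proof (rule has_field_derivative_transform_within_open)
    show "open {a<..<b}" "w \<in> {a<..<b}" using ab by auto
    show "cdf (distr P borel (Y 1)) a + integral {a..x} f = cdf (distr P borel (Y 1)) x" if "x \<in> {a<..<b}" for x
      using eq[of x] that by simp
  qed
qed

lemma ccr_U_deriv: "0 < w \<Longrightarrow> (ccr_U \<alpha> P Y has_real_derivative \<alpha> * f w) (at w)"
  using cdf_Y_deriv[of w] \<alpha>
  by (cases "\<alpha> = -1") (auto simp: ccr_U_def[abs_def] intro!: derivative_eq_intros)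

text \<open>A zero of \<open>ccr_U\<close> would be a minimum, forcing its derivative
  \<open>\<alpha> * f w\<close> to vanish.\<close>

lemma ccr_U_pos:
  assumes "0 < w" "0 < f w" shows "0 < ccr_U \<alpha> P Y w"
proof (rule ccontr)
  assume "\<not> 0 < ccr_U \<alpha> P Y w"
  then have "ccr_U \<alpha> P Y w = 0" using ccr_U_range[of \<alpha> w] by auto
  then have "\<alpha> * f w = 0"
    using ccr_U_range[of \<alpha>] by (intro DERIV_local_min[OF ccr_U_deriv[OF assms(1)] zero_less_one]) auto
  then show False using assms \<alpha> by auto
qed

lemma deriv_f_zero: "0 < w \<Longrightarrow> f w = 0 \<Longrightarrow> deriv f w = 0"
  using f_nonneg by (intro DERIV_local_min[OF f_deriv zero_less_one]) auto

text \<open>\<open>ccr_U\<close> may attain 0 or 1, where \<open>G\<close> has only a one-sided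
  derivative; the chain rule within the range of \<open>ccr_U\<close> copes with this.\<close>

lemma compose_ccr_U_deriv:
  assumes "0 < w" and G: "\<And>x. x \<in> {0..1} \<Longrightarrow> (G has_real_derivative G' x) (at x within {0..1})"
  shows "((\<lambda>w. G (ccr_U \<alpha> P Y w)) has_real_derivative \<alpha> * f w * G' (ccr_U \<alpha> P Y w)) (at w)"
proof -
  have "(G has_real_derivative G' (ccr_U \<alpha> P Y w)) (at (ccr_U \<alpha> P Y w) within range (ccr_U \<alpha> P Y))"
    using ccr_U_range by (intro has_field_derivative_subset[OF G]) auto
  from DERIV_image_chain[OF this ccr_U_deriv[OF assms(1)]]
  show ?thesis by (simp add: o_def mult.commute)
qed

lemma ccr_pdf_nonneg: "0 \<le> ccr_pdf \<alpha> P N Y f w"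
  unfolding ccr_pdf_def using f_nonneg pgf'_nonneg[OF ccr_U_range] by simp

text \<open>Where \<open>f\<close> is positive, so are \<open>ccr_U\<close> and \<open>pgf'\<close>
  there, and the divisions in the score are genuine. Where \<open>f\<close> vanishes, its derivative
  does too and both sides are 0. Thus the equation holds on the whole positive half-line.\<close>

lemma ccr_pdf_deriv:
  assumes "0 < w"
  shows "(ccr_pdf \<alpha> P N Y f has_real_derivative ccr_score \<alpha> P N Y f w * ccr_pdf \<alpha> P N Y f w) (at w)"
proof -
  let ?U = "ccr_U \<alpha> P Y w"
  have "(ccr_pdf \<alpha> P N Y f has_real_derivative
      deriv f w * pgf' P N ?U + \<alpha> * f w * pgf'' P N ?U * f w) (at w)"
    unfolding ccr_pdf_def[abs_def]
    by (rule DERIV_mult[OF f_deriv[OF assms] compose_ccr_U_deriv[OF assms pgf'_has_derivative]])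
  moreover have "deriv f w * pgf' P N ?U + \<alpha> * f w * pgf'' P N ?U * f w =
      ccr_score \<alpha> P N Y f w * ccr_pdf \<alpha> P N Y f w"
  proof (cases "f w = 0")
    case True
    then show ?thesis using deriv_f_zero[OF assms] by (simp add: ccr_pdf_def)
  next
    case False
    then have "0 < f w" using f_nonneg[of w] by simp
    then have "0 < pgf' P N ?U" using ccr_U_pos[OF assms] ccr_U_range[of \<alpha> w] by (intro pgf'_pos) auto
    then show ?thesis using \<open>0 < f w\<close>
      by (simp add: ccr_score_def ccr_pdf_def score_def field_simps)
  qed
  ultimately show ?thesis by simp
qed

lemma isCont_ccr_pdf: "0 < w \<Longrightarrow> isCont (ccr_pdf \<alpha> P N Y f) w"
  by (rule DERIV_isCont[OF ccr_pdf_deriv])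

text \<open>At zeros of \<open>f\<close> both sides are 0 by the convention on division. This form
  yields Borel measurability of the score without looking at \<open>pgf''\<close>.\<close>

lemma ccr_score_eq:
  assumes "0 < w"
  shows "ccr_score \<alpha> P N Y f w = deriv (ccr_pdf \<alpha> P N Y f) w / ccr_pdf \<alpha> P N Y f w"
proof (cases "f w = 0")
  case True
  then show ?thesis by (simp add: ccr_score_def ccr_pdf_def score_def)
next
  case False
  then have "0 < f w" using f_nonneg[of w] by simp
  then have "0 < ccr_pdf \<alpha> P N Y f w"
    using ccr_U_pos[OF assms] ccr_U_range[of \<alpha> w] unfolding ccr_pdf_def by (intro mult_pos_pos pgf'_pos) auto
  then show ?thesis using DERIV_imp_deriv[OF ccr_pdf_deriv[OF assms]] by simp
qed

lemma ccr_pdf_measurable: "(\<lambda>w. indicator {0<..} w * ccr_pdf \<alpha> P N Y f w) \<in> borel_measurable borel"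
  using borel_measurable_continuous_on_indicator[of "{0<..}" "ccr_pdf \<alpha> P N Y f"] isCont_ccr_pdf
  by (simp add: continuous_on_eq_continuous_at)

lemma ccr_score_measurable: "(\<lambda>w. indicator {0<..} w * ccr_score \<alpha> P N Y f w) \<in> borel_measurable borel"
proof -
  have [measurable]: "(\<lambda>w. indicator {0<..} w * deriv (ccr_pdf \<alpha> P N Y f) w) \<in> borel_measurable borel"
    by (rule borel_measurable_deriv_on_open)
       (auto simp: real_differentiable_def intro!: exI ccr_pdf_deriv)
  note ccr_pdf_measurable[measurable]
  have "(\<lambda>w. (indicator {0<..} w * deriv (ccr_pdf \<alpha> P N Y f) w) /
      (indicator {0<..} w * ccr_pdf \<alpha> P N Y f w)) \<in> borel_measurable borel"
    by measurable
  also have "(\<lambda>w. (indicator {0<..} w * deriv (ccr_pdf \<alpha> P N Y f) w) / (indicator {0<..} w * ccr_pdf \<alpha> P N Y f w)) =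
      (\<lambda>w. indicator {0<..} w * ccr_score \<alpha> P N Y f w)"
    by (auto simp: fun_eq_iff ccr_score_eq indicator_def)
  finally show ?thesis .
qed

text \<open>For minima the sign from passing to the complement cancels the \<open>\<alpha>\<close>
  in the derivative of \<open>ccr_U\<close>, so one formula serves both cases.\<close>

lemma ccr_W_density:
  "distr P borel (ccr_W \<alpha> N Y) = density lborel (\<lambda>w. ennreal (indicator {0<..} w * ccr_pdf \<alpha> P N Y f w))"
proof (rule distr_eq_density_cdf_deriv)
  have [measurable]: "ccr_W \<alpha> N Y \<in> borel_measurable P" by (rule ccr_W_measurable)
  have compl: "prob {\<omega> \<in> space P. ccr_W \<alpha> N Y \<omega> \<in> {..x}} = 1 - prob {\<omega> \<in> space P. ccr_W \<alpha> N Y \<omega> \<in> {x<..}}" for x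
    by (subst prob_compl[symmetric]) (auto intro!: arg_cong[where f=prob])
  have "ccr_W \<alpha> N Y -` {..x} \<inter> space P = {\<omega> \<in> space P. ccr_W \<alpha> N Y \<omega> \<in> {..x}}" for x by auto
  then have "cdf (distr P borel (ccr_W \<alpha> N Y)) x = prob {\<omega> \<in> space P. ccr_W \<alpha> N Y \<omega> \<in> {..x}}" for x
    by (simp add: cdf_def measure_distr)
  then have cdf: "cdf (distr P borel (ccr_W \<alpha> N Y)) =
      (\<lambda>x. if \<alpha> = -1 then 1 - pgf P N (ccr_U \<alpha> P Y x) else pgf P N (ccr_U \<alpha> P Y x))"
    using compl by (auto simp: fun_eq_iff pgf_ccr_U)
  show "(cdf (distr P borel (ccr_W \<alpha> N Y)) has_real_derivative ccr_pdf \<alpha> P N Y f w) (at w)" if "0 < w" for w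
    using compose_ccr_U_deriv[OF that pgf_has_derivative(1)] \<alpha> unfolding cdf ccr_pdf_def
    by (cases "\<alpha> = -1") (auto intro!: derivative_eq_intros)
qed (auto intro: prob_space_axioms ccr_W_measurable ccr_W_pos isCont_ccr_pdf ccr_pdf_nonneg)

definition pos_set :: "real set" where
  "pos_set = {0<..} \<inter> ccr_pdf \<alpha> P N Y f -` {0<..}"

lemma open_pos_set: "open pos_set"
  unfolding pos_set_def
  by (rule continuous_open_preimage) (auto intro!: continuous_at_imp_continuous_on isCont_ccr_pdf)

lemma AE_ccr_W_pos_set: "AE \<omega> in P. ccr_W \<alpha> N Y \<omega> \<in> pos_set"
proof (rule AE_distrD[OF ccr_W_measurable])
  have "(\<lambda>w. ennreal (indicator {0<..} w * ccr_pdf \<alpha> P N Y f w)) \<in> borel_measurable lborel"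
    using ccr_pdf_measurable by simp
  then show "AE w in distr P borel (ccr_W \<alpha> N Y). w \<in> pos_set"
    unfolding ccr_W_density
    by (subst AE_density) (auto intro!: AE_I2 simp: pos_set_def indicator_def)
qed

text \<open>The support is squeezed between an open set carrying all the mass and its closure. So
  its interior has full mass, and the density is positive on a dense part of it.\<close>

lemma rv_support_bounds:
  "pos_set \<subseteq> interior (rv_support P (ccr_W \<alpha> N Y))"
  "rv_support P (ccr_W \<alpha> N Y) \<subseteq> closure pos_set"
  "interior (rv_support P (ccr_W \<alpha> N Y)) \<subseteq> {0<..}"
proof -
  have [measurable]: "ccr_W \<alpha> N Y \<in> borel_measurable P" by (rule ccr_W_measurable)
  have dens: "(\<lambda>w. ennreal (indicator {0<..} w * ccr_pdf \<alpha> P N Y f w)) \<in> borel_measurable lborel"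
    using ccr_pdf_measurable by simp
  let ?S = "rv_support P (ccr_W \<alpha> N Y)"
  have "pos_set \<subseteq> ?S"
  proof
    fix x assume x: "x \<in> pos_set"
    have "0 < prob {\<omega> \<in> space P. dist (ccr_W \<alpha> N Y \<omega>) x < e}" if "0 < e" for e
    proof (rule ccontr)
      assume *: "\<not> ?thesis"
      \<comment> \<open>On this nonempty open set the density is positive, so zero mass would make
        it Lebesgue null.\<close>
      let ?V = "pos_set \<inter> ball x e"
      have V: "open ?V" "x \<in> ?V" "?V \<in> sets borel" using x \<open>0 < e\<close> open_pos_set by auto
      have "{\<omega> \<in> space P. dist (ccr_W \<alpha> N Y \<omega>) x < e} \<in> events" by measurable
      moreover have "prob {\<omega> \<in> space P. dist (ccr_W \<alpha> N Y \<omega>) x < e} = 0"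
        using * measure_nonneg[of P] by (simp add: order.antisym not_less)
      ultimately have "AE \<omega> in P. \<not> dist (ccr_W \<alpha> N Y \<omega>) x < e"
        by (subst AE_iff_measurable[OF _ refl]) (auto simp: emeasure_eq_measure)
      then have "AE \<omega> in P. ccr_W \<alpha> N Y \<omega> \<notin> ?V"
        by eventually_elim (auto simp: dist_commute)
      then have "AE w in density lborel (\<lambda>w. ennreal (indicator {0<..} w * ccr_pdf \<alpha> P N Y f w)). w \<notin> ?V"
        unfolding ccr_W_density[symmetric] using V(3) borel_comp[OF V(3)]
        by (subst AE_distr_iff) (simp_all add: Compl_eq)
      then have "AE w in lborel. w \<notin> ?V"
        unfolding AE_density[OF dens] by (auto elim!: eventually_mono simp: pos_set_def indicator_def)
      then have "?V \<in> null_sets lborel" using V(3) by (subst AE_iff_null_sets) auto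
      then have "negligible ?V"
        by (simp add: negligible_iff_null_sets null_sets_completionI)
      then show False using open_not_negligible[OF V(1)] V(2) by blast
    qed
    then show "x \<in> ?S" by (simp add: rv_support_def)
  qed
  then show "pos_set \<subseteq> interior ?S" using open_pos_set by (simp add: interior_maximal)
  show cl: "?S \<subseteq> closure pos_set"
  proof
    fix x assume x: "x \<in> ?S"
    have "\<exists>y\<in>pos_set. dist y x < e" if "0 < e" for e
    proof (rule ccontr)
      assume *: "\<not> ?thesis"
      have "prob {\<omega> \<in> space P. dist (ccr_W \<alpha> N Y \<omega>) x < e} = prob {}"
        using AE_ccr_W_pos_set * by (intro finite_measure_eq_AE) (auto elim!: eventually_mono)
      then show False using x \<open>0 < e\<close> by (auto simp: rv_support_def)
    qed
    then show "x \<in> closure pos_set" by (simp add: closure_approachable)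
  qed
  have "closure pos_set \<subseteq> {0..}" by (rule closure_minimal) (auto simp: pos_set_def)
  then have "interior ?S \<subseteq> interior {0..}" using cl by (intro interior_mono) auto
  then show "interior ?S \<subseteq> {0<..}" by simp
qed

text \<open>\<open>S\<close> is left free because both laws are later integrated over the interior
  of the support of the first variable. The indicator lets \<open>H\<close> be Borel on
  \<open>S\<close> only.\<close>

lemma expectation_ccr_W:
  assumes S: "open S" "pos_set \<subseteq> S" "S \<subseteq> {0<..}"
    and H: "(\<lambda>w. indicator S w * H w) \<in> borel_measurable borel"
    and int: "integrable P (\<lambda>\<omega>. H (ccr_W \<alpha> N Y \<omega>))"
  shows "set_integrable lborel S (\<lambda>w. ccr_pdf \<alpha> P N Y f w * H w)"
    and "(LINT w:S|lborel. ccr_pdf \<alpha> P N Y f w * H w) = expectation (\<lambda>\<omega>. H (ccr_W \<alpha> N Y \<omega>))"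
proof -
  note [measurable] = ccr_W_measurable H ccr_pdf_measurable
  let ?H = "\<lambda>w. indicator S w * H w"
  let ?p = "\<lambda>w. indicator {0<..} w * ccr_pdf \<alpha> P N Y f w"
  have AE: "AE \<omega> in P. H (ccr_W \<alpha> N Y \<omega>) = ?H (ccr_W \<alpha> N Y \<omega>)"
    using AE_ccr_W_pos_set by eventually_elim (use S in auto)
  have m: "(\<lambda>\<omega>. ?H (ccr_W \<alpha> N Y \<omega>)) \<in> borel_measurable P" by measurable
  have eq: "?p w * ?H w = indicator S w *\<^sub>R (ccr_pdf \<alpha> P N Y f w * H w)" for w
    using S(3) by (auto simp: indicator_def)
  have "integrable P (\<lambda>\<omega>. ?H (ccr_W \<alpha> N Y \<omega>))"
    using int AE m by (subst integrable_cong_AE[where g="\<lambda>\<omega>. H (ccr_W \<alpha> N Y \<omega>)"]) (auto elim!: eventually_mono)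
  then have "integrable (distr P borel (ccr_W \<alpha> N Y)) ?H"
    by (subst integrable_distr_eq) auto
  then have "integrable lborel (\<lambda>w. ?p w *\<^sub>R ?H w)"
    unfolding ccr_W_density
    by (subst (asm) integrable_density) (auto simp: ccr_pdf_nonneg)
  then show "set_integrable lborel S (\<lambda>w. ccr_pdf \<alpha> P N Y f w * H w)"
    unfolding set_integrable_def eq[symmetric] by simp
  have "expectation (\<lambda>\<omega>. H (ccr_W \<alpha> N Y \<omega>)) = expectation (\<lambda>\<omega>. ?H (ccr_W \<alpha> N Y \<omega>))"
    using AE m int by (intro integral_cong_AE) auto
  also have "\<dots> = (\<integral>w. ?H w \<partial>distr P borel (ccr_W \<alpha> N Y))"
    by (subst integral_distr) auto
  also have "\<dots> = (\<integral>w. ?p w *\<^sub>R ?H w \<partial>lborel)"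
    unfolding ccr_W_density by (subst integral_density) (auto simp: ccr_pdf_nonneg)
  finally show "(LINT w:S|lborel. ccr_pdf \<alpha> P N Y f w * H w) = expectation (\<lambda>\<omega>. H (ccr_W \<alpha> N Y \<omega>))"
    unfolding set_lebesgue_integral_def eq[symmetric] by simp
qed

end

end

section \<open>Comparison\<close>

text \<open>\<open>flux_identity\<close> with the densities \<open>p\<close>, \<open>q\<close> and
  the centred test function \<open>k\<close>. That \<open>k\<close> has mean 0 under the first law
  is the condition on the integral of \<open>p * k\<close>.\<close>

lemma ccr_stein_continuous:
  assumes \<alpha>: "\<alpha>\<^sub>1 \<in> {-1, 1}" "\<alpha>\<^sub>2 \<in> {-1, 1}"
    and ccr: "ccr P N Y" "ccr Q M Z"
    and supp: "rv_support Q (ccr_W \<alpha>\<^sub>2 M Z) \<subseteq> rv_support P (ccr_W \<alpha>\<^sub>1 N Y)"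
    and pdf: "has_differentiable_pdf P Y f\<^sub>Y" "has_differentiable_pdf Q Z f\<^sub>Z"
    and h: "integrable P (\<lambda>\<omega>. h (ccr_W \<alpha>\<^sub>1 N Y \<omega>))" "integrable Q (\<lambda>\<omega>. h (ccr_W \<alpha>\<^sub>2 M Z \<omega>))"
    and stein: "stein_solution \<alpha>\<^sub>1 P N Y f\<^sub>Y h g"
    and int: "integrable Q (\<lambda>\<omega>. g (ccr_W \<alpha>\<^sub>2 M Z \<omega>) *
      (ccr_score \<alpha>\<^sub>1 P N Y f\<^sub>Y (ccr_W \<alpha>\<^sub>2 M Z \<omega>) - ccr_score \<alpha>\<^sub>2 Q M Z f\<^sub>Z (ccr_W \<alpha>\<^sub>2 M Z \<omega>)))"
  shows "(\<integral>\<omega>. h (ccr_W \<alpha>\<^sub>2 M Z \<omega>) \<partial>Q) - (\<integral>\<omega>. h (ccr_W \<alpha>\<^sub>1 N Y \<omega>) \<partial>P) =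
    (\<integral>\<omega>. g (ccr_W \<alpha>\<^sub>2 M Z \<omega>) *
      (ccr_score \<alpha>\<^sub>1 P N Y f\<^sub>Y (ccr_W \<alpha>\<^sub>2 M Z \<omega>) - ccr_score \<alpha>\<^sub>2 Q M Z f\<^sub>Z (ccr_W \<alpha>\<^sub>2 M Z \<omega>)) \<partial>Q)"
proof -
  interpret P: ccr P N Y by fact
  interpret Q: ccr Q M Z by fact
  note Pf = pdf(1) \<alpha>(1) and Qf = pdf(2) \<alpha>(2)
  define S where "S = interior (rv_support P (ccr_W \<alpha>\<^sub>1 N Y))"
  define r1 where "r1 = ccr_score \<alpha>\<^sub>1 P N Y f\<^sub>Y"
  define r2 where "r2 = ccr_score \<alpha>\<^sub>2 Q M Z f\<^sub>Z"
  define p where "p = ccr_pdf \<alpha>\<^sub>1 P N Y f\<^sub>Y"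
  define q where "q = ccr_pdf \<alpha>\<^sub>2 Q M Z f\<^sub>Z"
  define m where "m = (\<integral>\<omega>. h (ccr_W \<alpha>\<^sub>1 N Y \<omega>) \<partial>P)"
  define k where "k w = h w - m" for w
  have S: "open S" "S \<subseteq> {0<..}" "P.pos_set f\<^sub>Y \<alpha>\<^sub>1 \<subseteq> S"
    using P.rv_support_bounds[OF Pf] by (auto simp: S_def)
  have "Q.pos_set f\<^sub>Z \<alpha>\<^sub>2 \<subseteq> rv_support Q (ccr_W \<alpha>\<^sub>2 M Z)"
    using Q.rv_support_bounds(1)[OF Qf] interior_subset by blast
  \<comment> \<open>The positivity set of \<open>q\<close> is open and lies in the larger support,
    hence in its interior, so the frontier carries no mass of the second law.\<close>
  then have SQ: "Q.pos_set f\<^sub>Z \<alpha>\<^sub>2 \<subseteq> S"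
    unfolding S_def using supp Q.open_pos_set[OF Qf] by (intro interior_maximal) auto
  have dense: "S \<subseteq> closure {x. 0 < p x}"
  proof -
    have "S \<subseteq> closure (P.pos_set f\<^sub>Y \<alpha>\<^sub>1)"
      unfolding S_def using P.rv_support_bounds(2)[OF Pf] interior_subset by blast
    also have "\<dots> \<subseteq> closure {x. 0 < p x}"
      by (rule closure_mono) (auto simp: P.pos_set_def[OF Pf] p_def)
    finally show ?thesis .
  qed
  have g: "g differentiable (at w)" "deriv g w = k w - r1 w * g w" if "w \<in> S" for w
    using stein that by (auto simp: stein_solution_def S_def k_def m_def r1_def algebra_simps)

  have [measurable]: "S \<in> sets borel" using S(1) by simp
  have [measurable]: "(\<lambda>w. indicator S w * g w) \<in> borel_measurable borel"
    using borel_measurable_continuous_on_indicator[of S g] S(1) g(1)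
    by (auto simp: continuous_on_eq_continuous_at differentiable_imp_continuous_within)
  have [measurable]: "(\<lambda>w. indicator S w * deriv g w) \<in> borel_measurable borel"
    using S(1) g(1) by (rule borel_measurable_deriv_on_open)
  have [measurable]: "(\<lambda>w. indicator {0<..} w * r1 w) \<in> borel_measurable borel"
    "(\<lambda>w. indicator {0<..} w * r2 w) \<in> borel_measurable borel"
    unfolding r1_def r2_def by (rule P.ccr_score_measurable[OF Pf] Q.ccr_score_measurable[OF Qf])+
  \<comment> \<open>\<open>h\<close> is not assumed to be Borel; the Stein equation makes it Borel on \<open>S\<close>, where the mass is.\<close>
  have "(\<lambda>w. indicator S w * deriv g w + (indicator {0<..} w * r1 w) * (indicator S w * g w)) \<in> borel_measurable borel"
    by measurable
  also have "(\<lambda>w. indicator S w * deriv g w + (indicator {0<..} w * r1 w) * (indicator S w * g w)) = (\<lambda>w. indicator S w * k w)"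
    using g(2) S(2) by (auto simp: fun_eq_iff indicator_def)
  finally have km: "(\<lambda>w. indicator S w * k w) \<in> borel_measurable borel" .
  have "(\<lambda>w. (indicator S w * g w) * (indicator {0<..} w * r1 w - indicator {0<..} w * r2 w)) \<in> borel_measurable borel"
    by measurable
  also have "(\<lambda>w. (indicator S w * g w) * (indicator {0<..} w * r1 w - indicator {0<..} w * r2 w)) =
      (\<lambda>w. indicator S w * (g w * (r1 w - r2 w)))"
    using S(2) by (auto simp: fun_eq_iff indicator_def)
  finally have dm: "(\<lambda>w. indicator S w * (g w * (r1 w - r2 w))) \<in> borel_measurable borel" .

  have kP: "integrable P (\<lambda>\<omega>. k (ccr_W \<alpha>\<^sub>1 N Y \<omega>))" and kQ: "integrable Q (\<lambda>\<omega>. k (ccr_W \<alpha>\<^sub>2 M Z \<omega>))"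
    unfolding k_def using h by auto
  note pk = P.expectation_ccr_W[OF Pf S(1,3,2) km kP, folded p_def]
  note qk = Q.expectation_ccr_W[OF Qf S(1) SQ S(2) km kQ, folded q_def]
  note qd = Q.expectation_ccr_W[OF Qf S(1) SQ S(2) dm int[folded r1_def r2_def], folded q_def]
  have "(\<integral>\<omega>. h (ccr_W \<alpha>\<^sub>2 M Z \<omega>) \<partial>Q) - m = (\<integral>\<omega>. k (ccr_W \<alpha>\<^sub>2 M Z \<omega>) \<partial>Q)"
    unfolding k_def using h(2) by (simp add: Q.prob_space)
  also have "\<dots> = (LINT w:S|lborel. q w * k w)"
    by (rule qk(2)[symmetric])
  also have "\<dots> = (LINT w:S|lborel. q w * (g w * (r1 w - r2 w)))"
  proof (rule flux_identity[OF S(1)])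
    show "bdd_below S" using S(2) by (auto intro!: bdd_belowI[of _ 0])
    show "(p has_real_derivative r1 x * p x) (at x)" "(q has_real_derivative r2 x * q x) (at x)" if "x \<in> S" for x
      using P.ccr_pdf_deriv[OF Pf, of x] Q.ccr_pdf_deriv[OF Qf, of x] S(2) that
      by (auto simp: p_def q_def r1_def r2_def)
    show "0 \<le> p x" "0 \<le> q x" for x
      using P.ccr_pdf_nonneg[OF Pf] Q.ccr_pdf_nonneg[OF Qf] by (auto simp: p_def q_def)
    show "(g has_real_derivative k x - r1 x * g x) (at x)" if "x \<in> S" for x
      using g[OF that] by (simp add: DERIV_deriv_iff_real_differentiable[symmetric])
    have "(\<integral>\<omega>. k (ccr_W \<alpha>\<^sub>1 N Y \<omega>) \<partial>P) = 0"
      unfolding k_def using h(1) by (simp add: P.prob_space m_def)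
    with pk(2) show "(LINT x:S|lborel. p x * k x) = 0" by simp
    \<comment> \<open>Passing to the interior can only shrink the frontier, so the boundary clause
      of \<open>stein_solution\<close> covers every frontier point of \<open>S\<close>.\<close>
    show "((\<lambda>x. g x * p x) \<longlongrightarrow> 0) (at a within S)" if "a \<in> frontier S" for a
      using stein that frontier_interior_subset by (auto simp: stein_solution_def S_def p_def)
  qed (rule dense pk(1) qk(1) qd(1))+
  also note qd(2)
  finally show ?thesis unfolding m_def r1_def r2_def .
qed

text \<open>In terms of the masses, the backward score at \<open>n + 1\<close> is 1 minus the ratio
  of the masses at \<open>n\<close> and \<open>n + 1\<close>. Multiplying the Stein equation by the
  mass at \<open>n + 1\<close> then gives the telescoping increments of
  \<open>flux_identity_nat\<close>.\<close>

lemma ccr_stein_discrete: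
  assumes ccr: "ccr P N Y" "ccr Q M Z"
    and supp: "rv_support Q (ccr_W \<alpha>\<^sub>2 M Z) \<subseteq> rv_support P (ccr_W \<alpha>\<^sub>1 N Y)"
    and nat: "\<And>i. i \<ge> 1 \<Longrightarrow> AE \<omega> in P. Y i \<omega> \<in> \<nat>" "\<And>i. i \<ge> 1 \<Longrightarrow> AE \<omega> in Q. Z i \<omega> \<in> \<nat>"
    and h: "integrable P (\<lambda>\<omega>. h (ccr_W \<alpha>\<^sub>1 N Y \<omega>))" "integrable Q (\<lambda>\<omega>. h (ccr_W \<alpha>\<^sub>2 M Z \<omega>))"
    and stein: "discrete_stein_solution \<alpha>\<^sub>1 P N Y h g"
    and bdry: "vanishes_at_right_endpoints g (rv_support P (ccr_W \<alpha>\<^sub>1 N Y))"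
      "vanishes_at_right_endpoints g (rv_support Q (ccr_W \<alpha>\<^sub>2 M Z))"
    and D: "D = (\<lambda>w. g (w - 1) * (ccr_bscore \<alpha>\<^sub>1 P N Y w - ccr_bscore \<alpha>\<^sub>2 Q M Z w))"
    and int: "integrable Q (\<lambda>\<omega>. D (ccr_W \<alpha>\<^sub>2 M Z \<omega>))"
  shows "(\<integral>\<omega>. h (ccr_W \<alpha>\<^sub>2 M Z \<omega>) \<partial>Q) - (\<integral>\<omega>. h (ccr_W \<alpha>\<^sub>1 N Y \<omega>) \<partial>P) =
    (\<integral>\<omega>. D (ccr_W \<alpha>\<^sub>2 M Z \<omega>) \<partial>Q)"
proof -
  interpret P: ccr P N Y by fact
  interpret Q: ccr Q M Z by fact
  define p where "p = P.mass \<alpha>\<^sub>1"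
  define q where "q = Q.mass \<alpha>\<^sub>2"
  define m where "m = (\<integral>\<omega>. h (ccr_W \<alpha>\<^sub>1 N Y \<omega>) \<partial>P)"
  define k where "k w = h w - m" for w
  have nonneg: "0 \<le> p n" "0 \<le> q n" for n
    by (simp_all add: p_def q_def P.mass_def Q.mass_def)
  have in_P: "real n \<in> rv_support P (ccr_W \<alpha>\<^sub>1 N Y) \<longleftrightarrow> 0 < p n" for n
    by (simp add: P.rv_support_nat[OF nat(1)] p_def)
  have in_Q: "real n \<in> rv_support Q (ccr_W \<alpha>\<^sub>2 M Z) \<longleftrightarrow> 0 < q n" for n
    by (simp add: Q.rv_support_nat[OF nat(2)] q_def)
  have pq: "0 < p n" if "0 < q n" for n
    using supp that in_P[of n] in_Q[of n] by auto
  have bP: "bdiff (pgf P N \<circ> ccr_U \<alpha>\<^sub>1 P Y) (real n) = (if \<alpha>\<^sub>1 = -1 then -1 else 1) * p n" for n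
    unfolding p_def by (rule P.bdiff_pgf_ccr_U[OF nat(1)])
  have bQ: "bdiff (pgf Q M \<circ> ccr_U \<alpha>\<^sub>2 Q Z) (real n) = (if \<alpha>\<^sub>2 = -1 then -1 else 1) * q n" for n
    unfolding q_def by (rule Q.bdiff_pgf_ccr_U[OF nat(2)])
  have Suc1: "real (Suc n) - 1 = real n" for n by simp
  \<comment> \<open>The sign relating increments of the generating function to masses cancels in the
    quotient.\<close>
  have sP: "ccr_bscore \<alpha>\<^sub>1 P N Y (real (Suc n)) = 1 - p n / p (Suc n)" if "0 < p (Suc n)" for n
    using that unfolding ccr_bscore_def bdiff_def[of "bdiff _"] Suc1 bP by (simp add: field_simps)
  have sQ: "ccr_bscore \<alpha>\<^sub>2 Q M Z (real (Suc n)) = 1 - q n / q (Suc n)" if "0 < q (Suc n)" for n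
    using that unfolding ccr_bscore_def bdiff_def[of "bdiff _"] Suc1 bQ by (simp add: field_simps)
  have S: "g (real (Suc n)) - p n / p (Suc n) * g (real n) = k (real (Suc n))" if "0 < p (Suc n)" for n
  proof -
    have "bdiff g (real (Suc n)) + ccr_bscore \<alpha>\<^sub>1 P N Y (real (Suc n)) * g (real (Suc n) - 1) = k (real (Suc n))"
      using stein in_P[of "Suc n"] that by (simp only: discrete_stein_solution_def k_def m_def)
    then show ?thesis unfolding sP[OF that] Suc1 bdiff_def by (simp add: algebra_simps)
  qed
  have Dn: "D (real (Suc n)) = g (real n) * (q n / q (Suc n) - p n / p (Suc n))" if "0 < q (Suc n)" for n
    unfolding D Suc1 sP[OF pq[OF that]] sQ[OF that] by simp
  \<comment> \<open>When a run of support points ends at \<open>n\<close>, the increment to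
    \<open>n + 1\<close> reduces to minus the mass at \<open>n\<close> times \<open>g n\<close>; the
    boundary condition makes it 0.\<close>
  have vP: "g (real n) = 0" if "0 < p n" "p (Suc n) = 0" for n
    using bdry(1) in_P[of n] in_P[of "Suc n"] that by (auto simp: vanishes_at_right_endpoints_def add.commute)
  have vQ: "g (real n) = 0" if "0 < q n" "q (Suc n) = 0" for n
    using bdry(2) in_Q[of n] in_Q[of "Suc n"] that by (auto simp: vanishes_at_right_endpoints_def add.commute)
  have kP: "integrable P (\<lambda>\<omega>. k (ccr_W \<alpha>\<^sub>1 N Y \<omega>))" and kQ: "integrable Q (\<lambda>\<omega>. k (ccr_W \<alpha>\<^sub>2 M Z \<omega>))"
    unfolding k_def using h by auto
  have "(\<integral>\<omega>. k (ccr_W \<alpha>\<^sub>2 M Z \<omega>) \<partial>Q) = (\<integral>\<omega>. D (ccr_W \<alpha>\<^sub>2 M Z \<omega>) \<partial>Q)"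
  proof (rule flux_identity_nat[where p=p and q=q and g="\<lambda>n. g (real n)" and k="\<lambda>n. k (real n)" and d="\<lambda>n. D (real n)"])
    show "p 0 = 0" "q 0 = 0" by (simp_all add: p_def q_def P.mass_0[OF nat(1)] Q.mass_0[OF nat(2)])
    show "p (Suc n) * g (real (Suc n)) - p n * g (real n) = p (Suc n) * k (real (Suc n))" for n
    proof (cases "p (Suc n) = 0")
      case True
      then show ?thesis using vP[of n] nonneg(1)[of n] by (cases "p n = 0") auto
    next
      case False
      then have "0 < p (Suc n)" using nonneg(1)[of "Suc n"] by simp
      then show ?thesis unfolding S[OF \<open>0 < p (Suc n)\<close>, symmetric] by (simp add: field_simps)
    qed
    show "q (Suc n) * g (real (Suc n)) - q n * g (real n) = q (Suc n) * k (real (Suc n)) - q (Suc n) * D (real (Suc n))" for n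
    proof (cases "q (Suc n) = 0")
      case True
      then show ?thesis using vQ[of n] nonneg(2)[of n] by (cases "q n = 0") auto
    next
      case False
      then have "0 < q (Suc n)" using nonneg(2)[of "Suc n"] by simp
      then show ?thesis unfolding Dn[OF \<open>0 < q (Suc n)\<close>] S[OF pq[OF \<open>0 < q (Suc n)\<close>], symmetric]
        by (simp add: right_diff_distrib)
    qed
    have "(\<integral>\<omega>. k (ccr_W \<alpha>\<^sub>1 N Y \<omega>) \<partial>P) = 0"
      unfolding k_def using h(1) by (simp add: P.prob_space m_def)
    then show "(\<lambda>n. p n * k (real n)) sums 0"
      using P.expectation_ccr_W_sums(2)[OF nat(1) kP] by (simp add: p_def)
    show "(\<lambda>n. q n * k (real n)) sums (\<integral>\<omega>. k (ccr_W \<alpha>\<^sub>2 M Z \<omega>) \<partial>Q)"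
      unfolding q_def by (rule Q.expectation_ccr_W_sums(2)[OF nat(2) kQ])
    show "(\<lambda>n. q n * D (real n)) sums (\<integral>\<omega>. D (ccr_W \<alpha>\<^sub>2 M Z \<omega>) \<partial>Q)"
      unfolding q_def by (rule Q.expectation_ccr_W_sums(2)[OF nat(2) int])
    show "summable (\<lambda>n. \<bar>q n * D (real n)\<bar>)"
      unfolding q_def by (rule Q.expectation_ccr_W_sums(1)[where h=D, OF nat(2) int])
  qed (use nonneg pq Dn in auto)
  then show ?thesis unfolding k_def using h(2) by (simp add: Q.prob_space m_def)
qed

text \<open>The absolute values absorb the sign, since the Stein equation yields the second
  expectation minus the first. In the discrete part the two operators differ by
  \<open>g (w - 1)\<close> times the difference of the backward scores; hence the formula contains
  these scores themselves, without the pmf factors of the informal display.\<close>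

theorem proposition3p1:
  fixes P :: "'a measure" and N :: "'a \<Rightarrow> nat" and Y :: "nat \<Rightarrow> 'a \<Rightarrow> real"
    and Q :: "'b measure" and M :: "'b \<Rightarrow> nat" and Z :: "nat \<Rightarrow> 'b \<Rightarrow> real"
    and \<alpha>\<^sub>1 \<alpha>\<^sub>2 :: real
  assumes "\<alpha>\<^sub>1 \<in> {-1, 1}" and "\<alpha>\<^sub>2 \<in> {-1, 1}"
    and "ccr P N Y" and "ccr Q M Z"
    and "rv_support Q (ccr_W \<alpha>\<^sub>2 M Z) \<subseteq> rv_support P (ccr_W \<alpha>\<^sub>1 N Y)"
  shows
    "(\<forall>f\<^sub>Y f\<^sub>Z h g.
        has_differentiable_pdf P Y f\<^sub>Y \<longrightarrow> has_differentiable_pdf Q Z f\<^sub>Z \<longrightarrow>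
        integrable P (\<lambda>\<omega>. h (ccr_W \<alpha>\<^sub>1 N Y \<omega>)) \<longrightarrow>
        integrable Q (\<lambda>\<omega>. h (ccr_W \<alpha>\<^sub>2 M Z \<omega>)) \<longrightarrow>
        stein_solution \<alpha>\<^sub>1 P N Y f\<^sub>Y h g \<longrightarrow>
        (let
           W = ccr_W \<alpha>\<^sub>2 M Z;
           D = (\<lambda>w. g w *
                 (\<alpha>\<^sub>1 * f\<^sub>Y w * (pgf'' P N (ccr_U \<alpha>\<^sub>1 P Y w) / pgf' P N (ccr_U \<alpha>\<^sub>1 P Y w)) -
                  \<alpha>\<^sub>2 * f\<^sub>Z w * (pgf'' Q M (ccr_U \<alpha>\<^sub>2 Q Z w) / pgf' Q M (ccr_U \<alpha>\<^sub>2 Q Z w))));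
           R = (\<lambda>w. g w * (score f\<^sub>Y w - score f\<^sub>Z w))
         in
           integrable Q (\<lambda>\<omega>. D (W \<omega>)) \<longrightarrow> integrable Q (\<lambda>\<omega>. R (W \<omega>)) \<longrightarrow>
           \<bar>(\<integral>\<omega>. h (ccr_W \<alpha>\<^sub>1 N Y \<omega>) \<partial>P) - (\<integral>\<omega>. h (W \<omega>) \<partial>Q)\<bar> =
           \<bar>(\<integral>\<omega>. D (W \<omega>) \<partial>Q) + (\<integral>\<omega>. R (W \<omega>) \<partial>Q)\<bar>))
     \<and>
     ((\<forall>i\<ge>1. AE \<omega> in P. Y i \<omega> \<in> \<nat>) \<longrightarrow> (\<forall>i\<ge>1. AE \<omega> in Q. Z i \<omega> \<in> \<nat>) \<longrightarrow>
      (\<forall>h g.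
        integrable P (\<lambda>\<omega>. h (ccr_W \<alpha>\<^sub>1 N Y \<omega>)) \<longrightarrow>
        integrable Q (\<lambda>\<omega>. h (ccr_W \<alpha>\<^sub>2 M Z \<omega>)) \<longrightarrow>
        discrete_stein_solution \<alpha>\<^sub>1 P N Y h g \<longrightarrow>
        vanishes_at_right_endpoints g (rv_support P (ccr_W \<alpha>\<^sub>1 N Y)) \<longrightarrow>
        vanishes_at_right_endpoints g (rv_support Q (ccr_W \<alpha>\<^sub>2 M Z)) \<longrightarrow>
        (let
           W = ccr_W \<alpha>\<^sub>2 M Z;
           G\<^sub>1 = pgf P N \<circ> ccr_U \<alpha>\<^sub>1 P Y;
           G\<^sub>2 = pgf Q M \<circ> ccr_U \<alpha>\<^sub>2 Q Z;
           D = (\<lambda>w. g (w - 1) *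
                 (bdiff (bdiff G\<^sub>1) w / bdiff G\<^sub>1 w - bdiff (bdiff G\<^sub>2) w / bdiff G\<^sub>2 w))
         in
           integrable Q (\<lambda>\<omega>. D (W \<omega>)) \<longrightarrow>
           \<bar>(\<integral>\<omega>. h (ccr_W \<alpha>\<^sub>1 N Y \<omega>) \<partial>P) - (\<integral>\<omega>. h (W \<omega>) \<partial>Q)\<bar> =
           \<bar>\<integral>\<omega>. D (W \<omega>) \<partial>Q\<bar>)))"
proof (intro conjI allI impI)
  fix f\<^sub>Y f\<^sub>Z h g
  assume pdf: "has_differentiable_pdf P Y f\<^sub>Y" "has_differentiable_pdf Q Z f\<^sub>Z"
    and h: "integrable P (\<lambda>\<omega>. h (ccr_W \<alpha>\<^sub>1 N Y \<omega>))" "integrable Q (\<lambda>\<omega>. h (ccr_W \<alpha>\<^sub>2 M Z \<omega>))"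
    and stein: "stein_solution \<alpha>\<^sub>1 P N Y f\<^sub>Y h g"
  define W where "W = ccr_W \<alpha>\<^sub>2 M Z"
  define D where "D = (\<lambda>w. g w *
                 (\<alpha>\<^sub>1 * f\<^sub>Y w * (pgf'' P N (ccr_U \<alpha>\<^sub>1 P Y w) / pgf' P N (ccr_U \<alpha>\<^sub>1 P Y w)) -
                  \<alpha>\<^sub>2 * f\<^sub>Z w * (pgf'' Q M (ccr_U \<alpha>\<^sub>2 Q Z w) / pgf' Q M (ccr_U \<alpha>\<^sub>2 Q Z w))))"
  define R where "R = (\<lambda>w. g w * (score f\<^sub>Y w - score f\<^sub>Z w))"
  have eq: "g w * (ccr_score \<alpha>\<^sub>1 P N Y f\<^sub>Y w - ccr_score \<alpha>\<^sub>2 Q M Z f\<^sub>Z w) = D w + R w" for w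
    unfolding D_def R_def ccr_score_def by algebra
  have "\<bar>(\<integral>\<omega>. h (ccr_W \<alpha>\<^sub>1 N Y \<omega>) \<partial>P) - (\<integral>\<omega>. h (W \<omega>) \<partial>Q)\<bar> =
        \<bar>(\<integral>\<omega>. D (W \<omega>) \<partial>Q) + (\<integral>\<omega>. R (W \<omega>) \<partial>Q)\<bar>"
    if "integrable Q (\<lambda>\<omega>. D (W \<omega>))" "integrable Q (\<lambda>\<omega>. R (W \<omega>))"
  proof -
    have "(\<integral>\<omega>. h (W \<omega>) \<partial>Q) - (\<integral>\<omega>. h (ccr_W \<alpha>\<^sub>1 N Y \<omega>) \<partial>P) = (\<integral>\<omega>. D (W \<omega>) + R (W \<omega>) \<partial>Q)"
      using ccr_stein_continuous[OF assms pdf h stein] that by (simp add: eq W_def)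
    also have "\<dots> = (\<integral>\<omega>. D (W \<omega>) \<partial>Q) + (\<integral>\<omega>. R (W \<omega>) \<partial>Q)"
      using that by (rule Bochner_Integration.integral_add)
    finally show ?thesis by (simp add: abs_minus_commute)
  qed
  then show "let W = ccr_W \<alpha>\<^sub>2 M Z;
           D = (\<lambda>w. g w *
                 (\<alpha>\<^sub>1 * f\<^sub>Y w * (pgf'' P N (ccr_U \<alpha>\<^sub>1 P Y w) / pgf' P N (ccr_U \<alpha>\<^sub>1 P Y w)) -
                  \<alpha>\<^sub>2 * f\<^sub>Z w * (pgf'' Q M (ccr_U \<alpha>\<^sub>2 Q Z w) / pgf' Q M (ccr_U \<alpha>\<^sub>2 Q Z w))));
           R = (\<lambda>w. g w * (score f\<^sub>Y w - score f\<^sub>Z w))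
         in integrable Q (\<lambda>\<omega>. D (W \<omega>)) \<longrightarrow> integrable Q (\<lambda>\<omega>. R (W \<omega>)) \<longrightarrow>
           \<bar>(\<integral>\<omega>. h (ccr_W \<alpha>\<^sub>1 N Y \<omega>) \<partial>P) - (\<integral>\<omega>. h (W \<omega>) \<partial>Q)\<bar> =
           \<bar>(\<integral>\<omega>. D (W \<omega>) \<partial>Q) + (\<integral>\<omega>. R (W \<omega>) \<partial>Q)\<bar>"
    unfolding Let_def W_def D_def R_def by blast
next
  fix h g
  assume nat: "\<forall>i\<ge>1. AE \<omega> in P. Y i \<omega> \<in> \<nat>" "\<forall>i\<ge>1. AE \<omega> in Q. Z i \<omega> \<in> \<nat>"
    and h: "integrable P (\<lambda>\<omega>. h (ccr_W \<alpha>\<^sub>1 N Y \<omega>))" "integrable Q (\<lambda>\<omega>. h (ccr_W \<alpha>\<^sub>2 M Z \<omega>))"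
    and stein: "discrete_stein_solution \<alpha>\<^sub>1 P N Y h g"
    and bdry: "vanishes_at_right_endpoints g (rv_support P (ccr_W \<alpha>\<^sub>1 N Y))"
      "vanishes_at_right_endpoints g (rv_support Q (ccr_W \<alpha>\<^sub>2 M Z))"
  show "let W = ccr_W \<alpha>\<^sub>2 M Z;
           G\<^sub>1 = pgf P N \<circ> ccr_U \<alpha>\<^sub>1 P Y;
           G\<^sub>2 = pgf Q M \<circ> ccr_U \<alpha>\<^sub>2 Q Z;
           D = (\<lambda>w. g (w - 1) *
                 (bdiff (bdiff G\<^sub>1) w / bdiff G\<^sub>1 w - bdiff (bdiff G\<^sub>2) w / bdiff G\<^sub>2 w))
         in integrable Q (\<lambda>\<omega>. D (W \<omega>)) \<longrightarrow>
           \<bar>(\<integral>\<omega>. h (ccr_W \<alpha>\<^sub>1 N Y \<omega>) \<partial>P) - (\<integral>\<omega>. h (W \<omega>) \<partial>Q)\<bar> =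
           \<bar>\<integral>\<omega>. D (W \<omega>) \<partial>Q\<bar>"
    unfolding Let_def ccr_bscore_def[symmetric]
  proof (intro impI)
    assume "integrable Q (\<lambda>\<omega>. g (ccr_W \<alpha>\<^sub>2 M Z \<omega> - 1) *
      (ccr_bscore \<alpha>\<^sub>1 P N Y (ccr_W \<alpha>\<^sub>2 M Z \<omega>) - ccr_bscore \<alpha>\<^sub>2 Q M Z (ccr_W \<alpha>\<^sub>2 M Z \<omega>)))"
    then have "(\<integral>\<omega>. h (ccr_W \<alpha>\<^sub>2 M Z \<omega>) \<partial>Q) - (\<integral>\<omega>. h (ccr_W \<alpha>\<^sub>1 N Y \<omega>) \<partial>P) =
      (\<integral>\<omega>. g (ccr_W \<alpha>\<^sub>2 M Z \<omega> - 1) *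
      (ccr_bscore \<alpha>\<^sub>1 P N Y (ccr_W \<alpha>\<^sub>2 M Z \<omega>) - ccr_bscore \<alpha>\<^sub>2 Q M Z (ccr_W \<alpha>\<^sub>2 M Z \<omega>)) \<partial>Q)"
      using nat by (intro ccr_stein_discrete[OF assms(3-5) _ _ h stein bdry refl]) auto
    then show "\<bar>(\<integral>\<omega>. h (ccr_W \<alpha>\<^sub>1 N Y \<omega>) \<partial>P) - (\<integral>\<omega>. h (ccr_W \<alpha>\<^sub>2 M Z \<omega>) \<partial>Q)\<bar> =
      \<bar>\<integral>\<omega>. g (ccr_W \<alpha>\<^sub>2 M Z \<omega> - 1) *
      (ccr_bscore \<alpha>\<^sub>1 P N Y (ccr_W \<alpha>\<^sub>2 M Z \<omega>) - ccr_bscore \<alpha>\<^sub>2 Q M Z (ccr_W \<alpha>\<^sub>2 M Z \<omega>)) \<partial>Q\<bar>"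
      by (simp add: abs_minus_commute)
  qed
qed

end
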